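(* Let $\kappa,\tau\in\mathbb R$. In the BCV-space $(\mathcal N_{\kappa,\tau},g_{\kappa,\tau})$, given a helicoidal surface $\psi(u,\theta)=(\xi_1(u),\theta,\xi_2(u)+a_0\theta)$ (cylindrical coordinates, $\xi_1>0$, profile curve parametrized by arc length in the orbit space), there exists a two-parameter family of helicoidal surfaces that are (locally) isometric to it and that includes a rotation surface. More precisely, let $U(u)>0$ be a smooth positive function and let $m\neq0$ and $a$ be arbitrary real constants. Put $$\Delta(u)=(1-2a\tau)^2+(m^2U(u)^2-a^2)(4\tau^2-\kappa),$$ $$\xi_1(u)=2\sqrt{\frac{m^2U^2-a^2}{(1+\sqrt{\Delta})^2-4\tau^2m^2U^2}},$$ $$\xi_2(u)=\int\frac{mU(4+\kappa\xi_1^2)}{4\xi_1^2}\sqrt{\xi_1^2-\frac{m^4U^2U'^2(4+\kappa\xi_1^2)^2}{16\Delta}}\,du,$$ $$\theta(u,t)=\frac tm+\int\frac{(4\tau-a\kappa)\xi_1^2-4a}{4mU\xi_1^2}\sqrt{\xi_1^2-\frac{m^4U^2U'^2(4+\kappa\xi_1^2)^2}{16\Delta}}\,du.$$ Then the helicoidal surfaces of pitch $a$ $$(u,t)\mapsto\big(\xi_1(u),\ \theta(u,t),\ \xi_2(u)+a\,\theta(u,t)\big)$$ (in cylindrical coordinates $(r,\theta,z)$) have first fundamental form $$du^2+U(u)^2\,dt^2 .$$ In particular, for fixed $U$, all these surfaces (as $m$ and $a$ vary) are isometric to each other.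
   Context: For $\kappa,\tau\in\mathbb R$, the Bianchi-Cartan-Vranceanu (BCV) space $\mathcal N_{\kappa,\tau}$ is the open subset of $\mathbb R^3$ where $B=1+\frac{\kappa}{4}(x^2+y^2)>0$, with the metric $g_{\kappa,\tau}=\frac{dx^2+dy^2}{B^2}+\big(dz+\tau\frac{y\,dx-x\,dy}{B}\big)^2$. In cylindrical coordinates $x=r\cos\theta$, $y=r\sin\theta$, $z=z$ it reads $$g_{\kappa,\tau}=\frac{dr^2}{B^2}+r^2\Big(\frac{1+\tau^2r^2}{B^2}\Big)d\theta^2+dz^2-\frac{2\tau r^2}{B}\,d\theta\,dz,\qquad B=1+\tfrac{\kappa}{4}r^2 .$$ A helicoidal surface of pitch $a\in\mathbb R$ is a surface invariant under the one-parameter group of isometries generated by the Killing field $X=\partial_\theta+a\,\partial_z$; a rotation surface is one with $a=0$. Locally it is parametrized in cylindrical coordinates by $\psi(u,\theta)=(\xi_1(u),\theta,\xi_2(u)+a\theta)$, with profile curve $(\xi_1(u),\xi_2(u))$ in the orbit space $\{(\xi_1,\xi_2):\xi_1\ge0\}$. The profile curve is parametrized by arc length (with respect to the orbital distance metric) if $$\frac{\xi_1'^2}{B^2}+\frac{\xi_1^2\xi_2'^2}{\xi_1^2+(aB-\tau\xi_1^2)^2}=1,\qquad B=1+\tfrac{\kappa}{4}\xi_1^2 .$$ Conventions: everything is local. Given $U$, $m$, $a$, the formulas are considered on intervals of $u$ on which they make sense, i.e. $\Delta>0$, the expression under the root defining $\xi_1$ is well defined and positive (so $\xi_1>0$), $4+\kappa\xi_1^2>0$,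 and $\xi_1^2-\frac{m^4U^2U'^2(4+\kappa\xi_1^2)^2}{16\Delta}$ is nonnegative with smooth square root. $\int\cdots du$ denotes any antiderivative in $u$. Isometries between these surfaces are understood locally (same $u$-interval, same coordinates $(u,t)$). *)

theory Defs
  imports "HOL-Analysis.Analysis"
begin

text \<open>Smoothness on an open set: all iterated directional derivatives exist and are continuous.\<close>

primrec cont_diff_on :: "nat \<Rightarrow> 'a::real_normed_vector set \<Rightarrow> ('a \<Rightarrow> 'b::real_normed_vector) \<Rightarrow> bool"
  where
    "cont_diff_on 0 S f \<longleftrightarrow> continuous_on S f"
  | "cont_diff_on (Suc n) S f \<longleftrightarrow>
       (\<forall>x\<in>S. f differentiable (at x)) \<and>
       (\<forall>v. cont_diff_on n S (\<lambda>x. frechet_derivative f (at x) v))"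

definition smooth_on :: "'a::real_normed_vector set \<Rightarrow> ('a \<Rightarrow> 'b::real_normed_vector) \<Rightarrow> bool"
  where "smooth_on S f \<longleftrightarrow> (\<forall>n. cont_diff_on n S f)"

definition open_interval :: "real set \<Rightarrow> bool"
  where "open_interval J \<longleftrightarrow> open J \<and> is_interval J"


text \<open>The argument of \<open>bcv_B \<kappa>\<close> is the \<^emph>\<open>squared\<close> distance \<open>x\<^sup>2 + y\<^sup>2 = r\<^sup>2\<close> to the axis.
  The metric is given, in Cartesian coordinates, as the symmetric bilinear form at the point \<open>p\<close>
  whose quadratic form is
  \<open>(dx\<^sup>2 + dy\<^sup>2) / B\<^sup>2 + (dz + \<tau> (y dx - x dy) / B)\<^sup>2\<close>.\<close>

definition bcv_B :: "real \<Rightarrow> real \<Rightarrow> real"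
  where "bcv_B \<kappa> s = 1 + \<kappa> / 4 * s"

definition bcv_space :: "real \<Rightarrow> (real \<times> real \<times> real) set"
  where "bcv_space \<kappa> = {(x, y, z). 0 < bcv_B \<kappa> (x\<^sup>2 + y\<^sup>2)}"

definition bcv_metric ::
    "real \<Rightarrow> real \<Rightarrow> real \<times> real \<times> real \<Rightarrow> real \<times> real \<times> real \<Rightarrow> real \<times> real \<times> real \<Rightarrow> real"
  where "bcv_metric \<kappa> \<tau> p v w =
    (case p of (x, y, z) \<Rightarrow> case v of (v1, v2, v3) \<Rightarrow> case w of (w1, w2, w3) \<Rightarrow>
      let B = bcv_B \<kappa> (x\<^sup>2 + y\<^sup>2) in
        (v1 * w1 + v2 * w2) / B\<^sup>2
        + (v3 + \<tau> * (y * v1 - x * v2) / B) * (w3 + \<tau> * (y * w1 - x * w2) / B))"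

definition cylindrical :: "real \<Rightarrow> real \<Rightarrow> real \<Rightarrow> real \<times> real \<times> real"
  where "cylindrical r \<theta> z = (r * cos \<theta>, r * sin \<theta>, z)"


text \<open>Parametrized surfaces \<open>X\<close> on a parameter domain \<open>D\<close> of the plane. The first fundamental
  form is the pullback of the metric; it is meaningful where \<open>X\<close> is differentiable.\<close>

definition first_fundamental_form ::
    "real \<Rightarrow> real \<Rightarrow> (real \<times> real \<Rightarrow> real \<times> real \<times> real) \<Rightarrow>
     real \<times> real \<Rightarrow> real \<times> real \<Rightarrow> real \<times> real \<Rightarrow> real"
  where "first_fundamental_form \<kappa> \<tau> X p v w =
    bcv_metric \<kappa> \<tau> (X p) (frechet_derivative X (at p) v) (frechet_derivative X (at p) w)"

text \<open>The first fundamental form is \<open>du\<^sup>2 + U(u)\<^sup>2 dt\<^sup>2\<close>.\<close>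

definition has_natural_form ::
    "real \<Rightarrow> real \<Rightarrow> (real \<times> real) set \<Rightarrow> (real \<times> real \<Rightarrow> real \<times> real \<times> real) \<Rightarrow>
     (real \<Rightarrow> real) \<Rightarrow> bool"
  where "has_natural_form \<kappa> \<tau> D X U \<longleftrightarrow>
    (\<forall>(u, t)\<in>D. X differentiable (at (u, t)) \<and>
       (\<forall>du dt du' dt'. first_fundamental_form \<kappa> \<tau> X (u, t) (du, dt) (du', dt') =
          du * du' + (U u)\<^sup>2 * (dt * dt')))"

text \<open>Isometry in common coordinates: points with the same parameters correspond.\<close>

definition isometric_on ::
    "real \<Rightarrow> real \<Rightarrow> (real \<times> real) set \<Rightarrow> (real \<times> real \<Rightarrow> real \<times> real \<times> real) \<Rightarrow>
     (real \<times> real \<Rightarrow> real \<times> real \<times> real) \<Rightarrow> bool"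
  where "isometric_on \<kappa> \<tau> D X Y \<longleftrightarrow>
    (\<forall>p\<in>D. X differentiable (at p) \<and> Y differentiable (at p) \<and>
       (\<forall>v w. first_fundamental_form \<kappa> \<tau> X p v w = first_fundamental_form \<kappa> \<tau> Y p v w))"


text \<open>\<open>screw_motion a s\<close> is the time-\<open>s\<close> flow of the Killing field \<open>\<partial>\<^sub>\<theta> + a \<partial>\<^sub>z\<close>.\<close>

definition screw_motion :: "real \<Rightarrow> real \<Rightarrow> real \<times> real \<times> real \<Rightarrow> real \<times> real \<times> real"
  where "screw_motion a s = (\<lambda>(x, y, z).
    (x * cos s - y * sin s, x * sin s + y * cos s, z + a * s))"

definition helicoidal_surface ::
    "real \<Rightarrow> real \<Rightarrow> (real \<times> real) set \<Rightarrow> (real \<times> real \<Rightarrow> real \<times> real \<times> real) \<Rightarrow> bool"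
  where "helicoidal_surface \<kappa> a D X \<longleftrightarrow>
    X ` D \<subseteq> bcv_space \<kappa> \<and> smooth_on D X \<and>
    (\<forall>p\<in>D. inj (frechet_derivative X (at p))) \<and>
    (\<forall>s. screw_motion a s ` (X ` D) = X ` D)"

definition rotation_surface ::
    "real \<Rightarrow> (real \<times> real) set \<Rightarrow> (real \<times> real \<Rightarrow> real \<times> real \<times> real) \<Rightarrow> bool"
  where "rotation_surface \<kappa> D X \<longleftrightarrow> helicoidal_surface \<kappa> 0 D X"

definition helicoid_param ::
    "real \<Rightarrow> (real \<Rightarrow> real) \<Rightarrow> (real \<Rightarrow> real) \<Rightarrow> real \<times> real \<Rightarrow> real \<times> real \<times> real"
  where "helicoid_param a \<xi>1 \<xi>2 = (\<lambda>(u, \<theta>). cylindrical (\<xi>1 u) \<theta> (\<xi>2 u + a * \<theta>))"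

definition arc_length_profile ::
    "real \<Rightarrow> real \<Rightarrow> real \<Rightarrow> real set \<Rightarrow> (real \<Rightarrow> real) \<Rightarrow> (real \<Rightarrow> real) \<Rightarrow> bool"
  where "arc_length_profile \<kappa> \<tau> a J \<xi>1 \<xi>2 \<longleftrightarrow>
    (\<forall>u\<in>J. let B = bcv_B \<kappa> ((\<xi>1 u)\<^sup>2) in
       (deriv \<xi>1 u)\<^sup>2 / B\<^sup>2
       + (\<xi>1 u)\<^sup>2 * (deriv \<xi>2 u)\<^sup>2 / ((\<xi>1 u)\<^sup>2 + (a * B - \<tau> * (\<xi>1 u)\<^sup>2)\<^sup>2) = 1)"


definition bour_Delta :: "real \<Rightarrow> real \<Rightarrow> real \<Rightarrow> real \<Rightarrow> (real \<Rightarrow> real) \<Rightarrow> real \<Rightarrow> real"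
  where "bour_Delta \<kappa> \<tau> m a U u =
    (1 - 2 * a * \<tau>)\<^sup>2 + (m\<^sup>2 * (U u)\<^sup>2 - a\<^sup>2) * (4 * \<tau>\<^sup>2 - \<kappa>)"

definition bour_denom :: "real \<Rightarrow> real \<Rightarrow> real \<Rightarrow> real \<Rightarrow> (real \<Rightarrow> real) \<Rightarrow> real \<Rightarrow> real"
  where "bour_denom \<kappa> \<tau> m a U u =
    (1 + sqrt (bour_Delta \<kappa> \<tau> m a U u))\<^sup>2 - 4 * \<tau>\<^sup>2 * m\<^sup>2 * (U u)\<^sup>2"

definition bour_xi1 :: "real \<Rightarrow> real \<Rightarrow> real \<Rightarrow> real \<Rightarrow> (real \<Rightarrow> real) \<Rightarrow> real \<Rightarrow> real"
  where "bour_xi1 \<kappa> \<tau> m a U u =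
    2 * sqrt ((m\<^sup>2 * (U u)\<^sup>2 - a\<^sup>2) / bour_denom \<kappa> \<tau> m a U u)"

text \<open>The radicand in the integrands of \<open>\<xi>\<^sub>2\<close> and \<open>\<theta>\<close>.\<close>

definition bour_radicand :: "real \<Rightarrow> real \<Rightarrow> real \<Rightarrow> real \<Rightarrow> (real \<Rightarrow> real) \<Rightarrow> real \<Rightarrow> real"
  where "bour_radicand \<kappa> \<tau> m a U u =
    (bour_xi1 \<kappa> \<tau> m a U u)\<^sup>2
    - m ^ 4 * (U u)\<^sup>2 * (deriv U u)\<^sup>2 * (4 + \<kappa> * (bour_xi1 \<kappa> \<tau> m a U u)\<^sup>2)\<^sup>2
      / (16 * bour_Delta \<kappa> \<tau> m a U u)"

definition bour_xi2_integrand ::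
    "real \<Rightarrow> real \<Rightarrow> real \<Rightarrow> real \<Rightarrow> (real \<Rightarrow> real) \<Rightarrow> real \<Rightarrow> real"
  where "bour_xi2_integrand \<kappa> \<tau> m a U u =
    m * U u * (4 + \<kappa> * (bour_xi1 \<kappa> \<tau> m a U u)\<^sup>2) / (4 * (bour_xi1 \<kappa> \<tau> m a U u)\<^sup>2)
    * sqrt (bour_radicand \<kappa> \<tau> m a U u)"

definition bour_theta_integrand ::
    "real \<Rightarrow> real \<Rightarrow> real \<Rightarrow> real \<Rightarrow> (real \<Rightarrow> real) \<Rightarrow> real \<Rightarrow> real"
  where "bour_theta_integrand \<kappa> \<tau> m a U u =
    ((4 * \<tau> - a * \<kappa>) * (bour_xi1 \<kappa> \<tau> m a U u)\<^sup>2 - 4 * a)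
    / (4 * m * U u * (bour_xi1 \<kappa> \<tau> m a U u)\<^sup>2)
    * sqrt (bour_radicand \<kappa> \<tau> m a U u)"

text \<open>The formulas make sense on \<open>J\<close>. The quotient (not its two parts separately) has to be
  positive; the condition on \<open>bour_denom\<close> excludes division by zero.\<close>

definition bour_admissible ::
    "real \<Rightarrow> real \<Rightarrow> real set \<Rightarrow> (real \<Rightarrow> real) \<Rightarrow> real \<Rightarrow> real \<Rightarrow> bool"
  where "bour_admissible \<kappa> \<tau> J U m a \<longleftrightarrow>
    m \<noteq> 0 \<and>
    (\<forall>u\<in>J. 0 < bour_Delta \<kappa> \<tau> m a U u \<and>
           bour_denom \<kappa> \<tau> m a U u \<noteq> 0 \<and>
           0 < (m\<^sup>2 * (U u)\<^sup>2 - a\<^sup>2) / bour_denom \<kappa> \<tau> m a U u \<and>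
           0 < 4 + \<kappa> * (bour_xi1 \<kappa> \<tau> m a U u)\<^sup>2 \<and>
           0 \<le> bour_radicand \<kappa> \<tau> m a U u) \<and>
    smooth_on J (\<lambda>u. sqrt (bour_radicand \<kappa> \<tau> m a U u))"

text \<open>\<open>X\<close> is the surface with parameters \<open>m\<close>, \<open>a\<close> determined by \<open>U\<close>, for some choice \<open>\<xi>2\<close>, \<open>\<omega>\<close>
  of the two antiderivatives.\<close>

definition bour_surface ::
    "real \<Rightarrow> real \<Rightarrow> real set \<Rightarrow> (real \<Rightarrow> real) \<Rightarrow> real \<Rightarrow> real \<Rightarrow>
     (real \<times> real \<Rightarrow> real \<times> real \<times> real) \<Rightarrow> bool"
  where "bour_surface \<kappa> \<tau> J U m a X \<longleftrightarrow>
    bour_admissible \<kappa> \<tau> J U m a \<and>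
    (\<exists>\<xi>2 \<omega>.
       (\<forall>u\<in>J. (\<xi>2 has_real_derivative bour_xi2_integrand \<kappa> \<tau> m a U u) (at u)) \<and>
       (\<forall>u\<in>J. (\<omega> has_real_derivative bour_theta_integrand \<kappa> \<tau> m a U u) (at u)) \<and>
       X = (\<lambda>(u, t). helicoid_param a (bour_xi1 \<kappa> \<tau> m a U) \<xi>2 (u, t / m + \<omega> u)))"

end

theory Submission
  imports Defs
begin

text \<open>
  Write \<open>R = \<xi>\<^sub>1\<^sup>2\<close>, \<open>B = 1 + \<kappa>R/4\<close> and \<open>K = aB - \<tau>R\<close>. The Killing field has squared length
  \<open>(R + K\<^sup>2) / B\<^sup>2\<close>, and \<open>\<xi>\<^sub>1\<close> is chosen so that this equals \<open>m\<^sup>2 U\<^sup>2\<close>: this is a quadratic equation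
  for \<open>R\<close> with discriminant \<open>\<Delta>\<close>. Differentiating it gives
  \<open>\<xi>\<^sub>1' = m\<^sup>2 U U' B\<^sup>2 / (\<xi>\<^sub>1 \<surd>\<Delta>)\<close>, so that the radicand is \<open>R (1 - \<xi>\<^sub>1'\<^sup>2 / B\<^sup>2)\<close>. The formula for
  \<open>\<xi>\<^sub>2\<close> is then the arc length condition, and the formula for \<open>\<theta>\<close> says that the \<open>u\<close>-curves are
  orthogonal to the Killing field.

  A given helicoidal surface determines \<open>U\<close> and has natural parameters after a shift of \<open>\<theta>\<close> by a
  function of \<open>u\<close>. For \<open>a = 0\<close> and small \<open>m \<noteq> 0\<close> all the conditions on \<open>(m, a)\<close> hold strictly at
  the given point, hence in a neighbourhood of \<open>(u\<^sub>0, m, 0)\<close>; the radicand is positive there, so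
  that its square root is smooth.
\<close>

section \<open>Smooth maps\<close>

lemma cont_diff_on_subset: "cont_diff_on n S f \<Longrightarrow> T \<subseteq> S \<Longrightarrow> cont_diff_on n T f"
proof (induction n arbitrary: f)
  case 0
  then show ?case using continuous_on_subset by auto
next
  case (Suc n)
  then show ?case by (simp add: subset_iff)
qed

text \<open>On an open set the derivative at a point depends only on values in \<open>S\<close>, so
  the derivatives of \<open>f\<close> and \<open>g\<close> agree on \<open>S\<close> and the
  induction can pass to the directional derivatives.\<close>

lemma cont_diff_on_cong:
  assumes "open S" "\<And>x. x \<in> S \<Longrightarrow> f x = g x" "cont_diff_on n S f"
  shows "cont_diff_on n S g"
  using assms(2,3)
proof (induction n arbitrary: f g)
  case 0
  then show ?case by (metis cont_diff_on.simps(1) continuous_on_cong)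
next
  case (Suc n)
  have D: "(g has_derivative frechet_derivative f (at x)) (at x)" if "x \<in> S" for x
    using Suc.prems that assms(1)
    by (metis cont_diff_on.simps(2) frechet_derivative_works has_derivative_transform_within_open)
  have "frechet_derivative f (at x) v = frechet_derivative g (at x) v" if "x \<in> S" for x v
    using frechet_derivative_at[OF D[OF that]] by simp
  then have "cont_diff_on n S (\<lambda>x. frechet_derivative g (at x) v)" for v
    using Suc.IH[of "\<lambda>x. frechet_derivative f (at x) v"] Suc.prems(2) by simp
  with D show ?case by (auto simp: differentiable_def)
qed

text \<open>Replaces the choice operator in \<open>frechet_derivative\<close> by any derivative
  \<open>D\<close> that the differentiation rules supply. The inductions below for sums, products,
  pairs and composites rest on it.\<close>

lemma cont_diff_on_SucI:
  assumes "open S" "\<And>x. x \<in> S \<Longrightarrow> (f has_derivative D x) (at x)"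
    "\<And>v. cont_diff_on n S (\<lambda>x. D x v)"
  shows "cont_diff_on (Suc n) S f"
proof -
  have "D x v = frechet_derivative f (at x) v" if "x \<in> S" for x v
    using frechet_derivative_at[OF assms(2)[OF that]] by simp
  then have "cont_diff_on n S (\<lambda>x. frechet_derivative f (at x) v)" for v
    by (rule cont_diff_on_cong[OF assms(1) _ assms(3)])
  with assms(2) show ?thesis by (auto simp: differentiable_def)
qed

lemma cont_diff_on_Suc_has_derivative:
  "cont_diff_on (Suc n) S f \<Longrightarrow> x \<in> S \<Longrightarrow> (f has_derivative frechet_derivative f (at x)) (at x)"
  using frechet_derivative_works[of f "at x"] by simp

text \<open>Serves the product and chain rules, where the derivative still contains undifferentiated
  functions that have to be handled at order \<open>n\<close>.\<close>

lemma cont_diff_on_Suc_imp: "cont_diff_on (Suc n) S f \<Longrightarrow> cont_diff_on n S f"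
proof (induction n arbitrary: f)
  case 0
  then show ?case
    by (auto intro: differentiable_imp_continuous_on simp: differentiable_on_def
        differentiable_at_withinI)
next
  case (Suc n)
  from Suc.prems have "\<forall>x\<in>S. f differentiable (at x)"
    and "\<And>v. cont_diff_on (Suc n) S (\<lambda>x. frechet_derivative f (at x) v)"
    using cont_diff_on.simps(2)[of "Suc n" S f] by blast+
  with Suc.IH show ?case by simp
qed

lemma cont_diff_on_const: "cont_diff_on n S (\<lambda>x. c)"
  by (induction n arbitrary: c) auto

lemma cont_diff_on_add:
  assumes "open S" "cont_diff_on n S f" "cont_diff_on n S g"
  shows "cont_diff_on n S (\<lambda>x. f x + g x)"
  using assms(2,3)
proof (induction n arbitrary: f g)
  case 0
  then show ?case by (simp add: continuous_on_add)
next
  case (Suc n)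
  show ?case
  proof (rule cont_diff_on_SucI[OF assms(1)])
    fix x assume "x \<in> S"
    with Suc.prems show "((\<lambda>x. f x + g x) has_derivative
        (\<lambda>v. frechet_derivative f (at x) v + frechet_derivative g (at x) v)) (at x)"
      by (intro has_derivative_add cont_diff_on_Suc_has_derivative)
  qed (use Suc in simp)
qed

lemma cont_diff_on_mult:
  fixes f g :: "'a::real_normed_vector \<Rightarrow> real"
  assumes "open S" "cont_diff_on n S f" "cont_diff_on n S g"
  shows "cont_diff_on n S (\<lambda>x. f x * g x)"
  using assms(2,3)
proof (induction n arbitrary: f g)
  case 0
  then show ?case by (simp add: continuous_on_mult)
next
  case (Suc n)
  show ?case
  proof (rule cont_diff_on_SucI[OF assms(1)])
    fix x assume "x \<in> S"
    with Suc.prems show "((\<lambda>x. f x * g x) has_derivative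
        (\<lambda>v. f x * frechet_derivative g (at x) v + frechet_derivative f (at x) v * g x)) (at x)"
      by (intro has_derivative_mult cont_diff_on_Suc_has_derivative)
  next
    fix v
    have "cont_diff_on n S f" "cont_diff_on n S g"
      using Suc.prems cont_diff_on_Suc_imp by blast+
    with Suc show "cont_diff_on n S
        (\<lambda>x. f x * frechet_derivative g (at x) v + frechet_derivative f (at x) v * g x)"
      by (intro cont_diff_on_add assms(1)) auto
  qed
qed

lemma cont_diff_on_Pair:
  assumes "open S" "cont_diff_on n S f" "cont_diff_on n S g"
  shows "cont_diff_on n S (\<lambda>x. (f x, g x))"
  using assms(2,3)
proof (induction n arbitrary: f g)
  case 0
  then show ?case by (simp add: continuous_on_Pair)
next
  case (Suc n)
  show ?case
  proof (rule cont_diff_on_SucI[OF assms(1)])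
    fix x assume "x \<in> S"
    with Suc.prems show "((\<lambda>x. (f x, g x)) has_derivative
        (\<lambda>v. (frechet_derivative f (at x) v, frechet_derivative g (at x) v))) (at x)"
      by (intro has_derivative_Pair cont_diff_on_Suc_has_derivative)
  qed (use Suc in simp)
qed

text \<open>Since \<open>f\<close> is real valued, linearity pulls its directional derivative out of
  the derivative of \<open>g\<close>. What remains is a product of two functions, and the induction
  hypothesis applies to the factor that composes the derivative of \<open>g\<close> in direction
  \<open>1\<close> with \<open>f\<close>.\<close>

lemma cont_diff_on_compose:
  fixes f :: "'a::real_normed_vector \<Rightarrow> real" and g :: "real \<Rightarrow> real"
  assumes "open S" "f ` S \<subseteq> T" "cont_diff_on n T g" "cont_diff_on n S f"
  shows "cont_diff_on n S (\<lambda>x. g (f x))"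
  using assms(2-4)
proof (induction n arbitrary: f g)
  case 0
  then show ?case by (auto intro: continuous_on_compose2)
next
  case (Suc n)
  show ?case
  proof (rule cont_diff_on_SucI[OF assms(1)])
    fix x assume x: "x \<in> S"
    with Suc.prems have "(g has_derivative frechet_derivative g (at (f x))) (at (f x))"
      by (intro cont_diff_on_Suc_has_derivative[of n T]) auto
    then have D: "((\<lambda>x. g (f x)) has_derivative
        (\<lambda>v. frechet_derivative g (at (f x)) (frechet_derivative f (at x) v))) (at x)"
      using has_derivative_compose[OF cont_diff_on_Suc_has_derivative[OF Suc.prems(3) x]] by blast
    have "linear (frechet_derivative g (at (f x)))"
      using Suc.prems x by (intro linear_frechet_derivative) auto
    then have L: "frechet_derivative g (at (f x)) c = c * frechet_derivative g (at (f x)) 1" for c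
      using linear_cmul[of "frechet_derivative g (at (f x))" c 1] by simp
    show "((\<lambda>x. g (f x)) has_derivative
        (\<lambda>v. frechet_derivative f (at x) v * frechet_derivative g (at (f x)) 1)) (at x)"
      by (rule has_derivative_eq_rhs[OF D]) (rule ext, rule L)
  next
    fix v
    have "cont_diff_on n S f"
      using Suc.prems cont_diff_on_Suc_imp by blast
    with Suc.prems Suc.IH[of f "\<lambda>y. frechet_derivative g (at y) 1"]
    show "cont_diff_on n S
        (\<lambda>x. frechet_derivative f (at x) v * frechet_derivative g (at (f x)) 1)"
      by (intro cont_diff_on_mult assms(1)) auto
  qed
qed

lemma cont_diff_on_real_SucI:
  fixes f :: "real \<Rightarrow> real"
  assumes "open S" "\<And>x. x \<in> S \<Longrightarrow> (f has_real_derivative f' x) (at x)" "cont_diff_on n S f'"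
  shows "cont_diff_on (Suc n) S f"
  using assms by (intro cont_diff_on_SucI[where D = "\<lambda>x v. f' x * v"])
    (auto simp: has_field_derivative_def intro: cont_diff_on_mult cont_diff_on_const)

section \<open>Closure properties of smoothness and the elementary functions\<close>

lemma smooth_on_const: "smooth_on S (\<lambda>x. c)"
  by (simp add: smooth_on_def cont_diff_on_const)

lemma smooth_on_linear:
  assumes "bounded_linear f"
  shows "smooth_on S f"
  unfolding smooth_on_def
proof
  fix n
  show "cont_diff_on n S f"
  proof (cases n)
    case 0
    then show ?thesis using assms by (simp add: linear_continuous_on)
  next
    case (Suc k)
    have D: "(f has_derivative f) (at x)" for x
      by (rule bounded_linear_imp_has_derivative[OF assms])
    have "frechet_derivative f (at x) = f" for x
      by (rule frechet_derivative_at[OF D, symmetric])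
    with D Suc show ?thesis
      by (auto simp: cont_diff_on_const differentiable_def)
  qed
qed

lemma smooth_on_subset: "smooth_on S f \<Longrightarrow> T \<subseteq> S \<Longrightarrow> smooth_on T f"
  using cont_diff_on_subset unfolding smooth_on_def by blast

lemma smooth_on_add: "open S \<Longrightarrow> smooth_on S f \<Longrightarrow> smooth_on S g \<Longrightarrow> smooth_on S (\<lambda>x. f x + g x)"
  unfolding smooth_on_def using cont_diff_on_add by blast

lemma smooth_on_mult:
  fixes f g :: "'a::real_normed_vector \<Rightarrow> real"
  shows "open S \<Longrightarrow> smooth_on S f \<Longrightarrow> smooth_on S g \<Longrightarrow> smooth_on S (\<lambda>x. f x * g x)"
  by (simp add: smooth_on_def cont_diff_on_mult)

lemma smooth_on_diff:
  fixes f g :: "'a::real_normed_vector \<Rightarrow> real"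
  shows "open S \<Longrightarrow> smooth_on S f \<Longrightarrow> smooth_on S g \<Longrightarrow> smooth_on S (\<lambda>x. f x - g x)"
  using smooth_on_add[of S f "\<lambda>x. (-1) * g x"] smooth_on_mult[of S "\<lambda>x. -1" g]
  by (simp add: smooth_on_const del: mult_minus_left)

lemma smooth_on_power:
  fixes f :: "'a::real_normed_vector \<Rightarrow> real"
  shows "open S \<Longrightarrow> smooth_on S f \<Longrightarrow> smooth_on S (\<lambda>x. f x ^ n)"
  by (induction n) (auto intro: smooth_on_const smooth_on_mult)

lemma smooth_on_Pair:
  "open S \<Longrightarrow> smooth_on S f \<Longrightarrow> smooth_on S g \<Longrightarrow> smooth_on S (\<lambda>x. (f x, g x))"
  unfolding smooth_on_def using cont_diff_on_Pair by blast

lemma smooth_on_compose: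
  fixes f :: "'a::real_normed_vector \<Rightarrow> real" and g :: "real \<Rightarrow> real"
  shows "smooth_on T g \<Longrightarrow> open S \<Longrightarrow> smooth_on S f \<Longrightarrow> f ` S \<subseteq> T \<Longrightarrow> smooth_on S (\<lambda>x. g (f x))"
  by (simp add: smooth_on_def cont_diff_on_compose)

lemma smooth_on_sin_cos: "smooth_on UNIV (sin :: real \<Rightarrow> real)" "smooth_on UNIV (cos :: real \<Rightarrow> real)"
proof -
  \<comment> \<open>Both functions go through one induction, because each derivative is the other
    function up to sign.\<close>
  have "cont_diff_on n UNIV (sin :: real \<Rightarrow> real) \<and> cont_diff_on n UNIV (cos :: real \<Rightarrow> real)" for n
  proof (induction n)
    case 0
    then show ?case by (simp add: continuous_on_sin continuous_on_cos)
  next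
    case (Suc n)
    then have "cont_diff_on n UNIV (\<lambda>x::real. (-1) * sin x)"
      by (intro cont_diff_on_mult cont_diff_on_const) auto
    with Suc show ?case
      by (auto simp del: cont_diff_on.simps intro!: cont_diff_on_real_SucI[where f' = cos] DERIV_sin DERIV_cos
          cont_diff_on_real_SucI[where f = cos and f' = "\<lambda>x. - sin x"])
  qed
  then show "smooth_on UNIV (sin :: real \<Rightarrow> real)" "smooth_on UNIV (cos :: real \<Rightarrow> real)"
    by (auto simp: smooth_on_def)
qed

text \<open>The derivative is a polynomial in the function itself, so order \<open>n\<close> gives
  order \<open>n + 1\<close>.\<close>

lemma smooth_on_inverse_real: "smooth_on (- {0}) (inverse :: real \<Rightarrow> real)"
proof -
  have "cont_diff_on n (- {0}) (inverse :: real \<Rightarrow> real)" for n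
  proof (induction n)
    case 0
    then show ?case by (auto intro: continuous_on_inverse continuous_on_id)
  next
    case (Suc n)
    then have "cont_diff_on n (- {0::real}) (\<lambda>x. (-1) * (inverse x * inverse x))"
      by (intro cont_diff_on_mult cont_diff_on_const) auto
    then show ?case
      by (intro cont_diff_on_real_SucI[where f' = "\<lambda>x. (-1) * (inverse x * inverse x)"])
        (auto intro!: derivative_eq_intros simp del: cont_diff_on.simps)
  qed
  then show ?thesis by (simp add: smooth_on_def)
qed

text \<open>The derivative is half of \<open>inverse\<close> composed with the function itself, and
  \<open>inverse\<close> is smooth away from \<open>0\<close>, so the induction on the order
  closes.\<close>

lemma smooth_on_sqrt_real: "smooth_on {0<..} sqrt"
proof -
  have "cont_diff_on n {0<..} sqrt" for n
  proof (induction n)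
    case 0
    then show ?case by (simp add: continuous_on_real_sqrt continuous_on_id)
  next
    case (Suc n)
    have "cont_diff_on n {0<..} (\<lambda>x. inverse (sqrt x))"
      using smooth_on_inverse_real Suc
      by (intro cont_diff_on_compose[of "{0<..}" sqrt "- {0}" n inverse]) (auto simp: smooth_on_def)
    then have "cont_diff_on n {0<..} (\<lambda>x. inverse (sqrt x) * (1 / 2))"
      by (intro cont_diff_on_mult cont_diff_on_const) auto
    then show ?case
      by (intro cont_diff_on_real_SucI[where f' = "\<lambda>x. inverse (sqrt x) * (1 / 2)"])
        (use DERIV_real_sqrt in \<open>auto simp del: cont_diff_on.simps\<close>)
  qed
  then show ?thesis by (simp add: smooth_on_def)
qed

lemma smooth_on_divide:
  fixes f g :: "'a::real_normed_vector \<Rightarrow> real"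
  assumes "open S" "smooth_on S f" "smooth_on S g" "\<And>x. x \<in> S \<Longrightarrow> g x \<noteq> 0"
  shows "smooth_on S (\<lambda>x. f x / g x)"
  unfolding divide_inverse using assms
  by (intro smooth_on_mult smooth_on_compose[OF smooth_on_inverse_real, of S g]) auto

lemma smooth_on_sqrt:
  fixes f :: "'a::real_normed_vector \<Rightarrow> real"
  assumes "open S" "smooth_on S f" "\<And>x. x \<in> S \<Longrightarrow> 0 < f x"
  shows "smooth_on S (\<lambda>x. sqrt (f x))"
  using assms by (intro smooth_on_compose[OF smooth_on_sqrt_real, of S f]) auto

lemma smooth_on_has_real_derivative:
  assumes "smooth_on S f" "x \<in> S"
  shows "(f has_real_derivative deriv f x) (at x)"
proof -
  have "cont_diff_on (Suc 0) S f" using assms(1) by (simp add: smooth_on_def del: cont_diff_on.simps)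
  then show ?thesis using assms(2) by (simp add: DERIV_deriv_iff_real_differentiable)
qed

lemma smooth_on_continuous: "smooth_on S f \<Longrightarrow> continuous_on S f"
  using cont_diff_on.simps(1)[of S f] unfolding smooth_on_def by metis

lemma smooth_on_deriv:
  fixes f :: "real \<Rightarrow> real"
  assumes "open S" "smooth_on S f"
  shows "smooth_on S (deriv f)"
  unfolding smooth_on_def
proof
  fix n
  have "frechet_derivative f (at x) 1 = deriv f x" if "x \<in> S" for x
    using smooth_on_has_real_derivative[OF assms(2) that] frechet_derivative_at
    by (metis has_field_derivative_def mult.right_neutral)
  moreover have "cont_diff_on n S (\<lambda>x. frechet_derivative f (at x) 1)"
    using assms(2) cont_diff_on.simps(2)[of n S f] unfolding smooth_on_def by blast
  ultimately show "cont_diff_on n S (deriv f)"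
    by (rule cont_diff_on_cong[OF assms(1)])
qed

section \<open>Antiderivatives\<close>

lemma smooth_on_antiderivative:
  fixes f :: "real \<Rightarrow> real"
  assumes "open S" "smooth_on S f'" "\<And>x. x \<in> S \<Longrightarrow> (f has_real_derivative f' x) (at x)"
  shows "smooth_on S f"
proof -
  have "cont_diff_on (Suc n) S f" for n
    using assms by (intro cont_diff_on_real_SucI[where f' = f']) (auto simp: smooth_on_def)
  then show ?thesis using cont_diff_on_Suc_imp unfolding smooth_on_def by blast
qed

text \<open>An antiderivative on the compact interval has derivatives relative to that interval; at
  interior points these are two-sided, hence the open interval in the conclusion.\<close>

lemma real_antiderivative:
  fixes f :: "real \<Rightarrow> real"
  assumes "continuous_on {a..b} f"
  obtains F where "\<And>x. x \<in> {a<..<b} \<Longrightarrow> (F has_real_derivative f x) (at x)"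
proof -
  obtain F where "\<And>x. x \<in> {a..b} \<Longrightarrow> (F has_vector_derivative f x) (at x within {a..b})"
    using antiderivative_continuous[OF assms] by blast
  then have "(F has_real_derivative f x) (at x)" if "x \<in> {a<..<b}" for x
    using that at_within_Icc_at[of a x b]
    by (metis atLeastAtMost_iff greaterThanLessThan_iff has_real_derivative_iff_has_vector_derivative
        order_less_imp_le)
  then show thesis by (rule that)
qed

section \<open>Helicoidal surfaces\<close>

text \<open>Here \<open>q\<close> is the differential of the angle. The image vector is written
  through its cylindrical components \<open>r' * du\<close>, \<open>q\<close> and
  \<open>\<zeta>' * du + a * q\<close>, the shape that \<open>bcv_metric_cylindrical\<close>
  evaluates.\<close>

lemma helicoid_param_has_derivative:
  fixes r \<zeta> \<omega> :: "real \<Rightarrow> real"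
  assumes r: "(r has_real_derivative r') (at u)"
    and \<zeta>: "(\<zeta> has_real_derivative \<zeta>') (at u)"
    and \<omega>: "(\<omega> has_real_derivative \<omega>') (at u)"
    and \<theta>: "\<theta> = t / m + \<omega> u"
  shows "((\<lambda>(u, t). helicoid_param a r \<zeta> (u, t / m + \<omega> u)) has_derivative
     (\<lambda>(du, dt). let q = dt / m + \<omega>' * du in
        (r' * du * cos \<theta> - r u * sin \<theta> * q, r' * du * sin \<theta> + r u * cos \<theta> * q, \<zeta>' * du + a * q)))
     (at (u, t))"
proof -
  have F: "((\<lambda>p::real \<times> real. f (fst p)) has_derivative (\<lambda>v. f' * fst v)) (at (u, t))"
    if "(f has_real_derivative f') (at u)" for f f'
    using has_derivative_compose[OF has_derivative_fst[OF has_derivative_ident], of f "(*) f'" "(u, t)" UNIV] that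
    by (simp add: has_field_derivative_def)
  have T: "((\<lambda>p::real \<times> real. snd p / m + \<omega> (fst p)) has_derivative
      (\<lambda>v. snd v / m + \<omega>' * fst v)) (at (u, t))"
    by (intro has_derivative_add F[OF \<omega>] bounded_linear_imp_has_derivative
        bounded_linear_divide[THEN bounded_linear_compose] bounded_linear_snd)
  have "((\<lambda>p. (r (fst p) * cos (snd p / m + \<omega> (fst p)), r (fst p) * sin (snd p / m + \<omega> (fst p)),
          \<zeta> (fst p) + a * (snd p / m + \<omega> (fst p)))) has_derivative
      (\<lambda>v. (r (fst (u, t)) * ((snd v / m + \<omega>' * fst v) * - sin (snd (u, t) / m + \<omega> (fst (u, t))))
              + r' * fst v * cos (snd (u, t) / m + \<omega> (fst (u, t))),
            r (fst (u, t)) * ((snd v / m + \<omega>' * fst v) * cos (snd (u, t) / m + \<omega> (fst (u, t))))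
              + r' * fst v * sin (snd (u, t) / m + \<omega> (fst (u, t))),
            \<zeta>' * fst v + a * (snd v / m + \<omega>' * fst v)))) (at (u, t))"
    by (intro has_derivative_Pair has_derivative_mult F[OF r] has_derivative_add F[OF \<zeta>]
        has_derivative_cos has_derivative_sin has_derivative_mult_right T)
  then show ?thesis
    unfolding helicoid_param_def cylindrical_def
    \<comment> \<open>The two functions agree everywhere, so the radius \<open>1\<close> in the
      transformation rule is arbitrary.\<close>
    by (rule has_derivative_eq_rhs[OF has_derivative_transform_within[OF _ zero_less_one]])
       (auto simp: \<theta> Let_def fun_eq_iff algebra_simps)
qed

text \<open>The numbers \<open>p\<close>, \<open>q\<close>, \<open>s\<close> are the components of a
  tangent vector along the radius, the angle and the height. The identity
  \<open>y dx - x dy = - r^2 d\<theta>\<close> leads from the Cartesian to the cylindrical form of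
  the metric.\<close>

lemma bcv_metric_cylindrical:
  assumes "B = bcv_B \<kappa> (\<rho>\<^sup>2)"
  shows "bcv_metric \<kappa> \<tau> (cylindrical \<rho> \<theta> z)
      (p * cos \<theta> - \<rho> * sin \<theta> * q, p * sin \<theta> + \<rho> * cos \<theta> * q, s)
      (p' * cos \<theta> - \<rho> * sin \<theta> * q', p' * sin \<theta> + \<rho> * cos \<theta> * q', s')
    = (p * p' + \<rho>\<^sup>2 * q * q') / B\<^sup>2 + (s - \<tau> * \<rho>\<^sup>2 * q / B) * (s' - \<tau> * \<rho>\<^sup>2 * q' / B)"
proof -
  have C: "sin \<theta> * sin \<theta> = 1 - cos \<theta> * cos \<theta>"
    using sin_cos_squared_add[of \<theta>] by (simp add: power2_eq_square)
  have "(\<rho> * cos \<theta>)\<^sup>2 + (\<rho> * sin \<theta>)\<^sup>2 = \<rho>\<^sup>2"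
    using C by algebra
  moreover have "\<rho> * sin \<theta> * (p * cos \<theta> - \<rho> * sin \<theta> * q) - \<rho> * cos \<theta> * (p * sin \<theta> + \<rho> * cos \<theta> * q)
      = - \<rho>\<^sup>2 * q" for p q
    using C by algebra
  moreover have "(p * cos \<theta> - \<rho> * sin \<theta> * q) * (p' * cos \<theta> - \<rho> * sin \<theta> * q')
      + (p * sin \<theta> + \<rho> * cos \<theta> * q) * (p' * sin \<theta> + \<rho> * cos \<theta> * q') = p * p' + \<rho>\<^sup>2 * q * q'"
    using C by algebra
  ultimately show ?thesis
    using assms by (simp add: bcv_metric_def cylindrical_def Let_def mult.assoc)
qed

text \<open>The \<open>t\<close>-curves are orbits of the Killing field run at speed
  \<open>1 / m\<close>, so the second equation in \<open>N\<close> gives them length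
  \<open>U\<close>. Condition \<open>orth\<close> makes the \<open>u\<close>-curves orthogonal to
  the orbits, and \<open>arc\<close> then gives them unit speed.\<close>

lemma helicoid_param_first_fundamental_form:
  fixes r \<zeta> \<omega> :: "real \<Rightarrow> real"
  assumes r: "(r has_real_derivative r') (at u)"
    and \<zeta>: "(\<zeta> has_real_derivative \<zeta>') (at u)"
    and \<omega>: "(\<omega> has_real_derivative \<omega>') (at u)"
    and B: "B = bcv_B \<kappa> ((r u)\<^sup>2)" "B \<noteq> 0"
    and K: "K = a * B - \<tau> * (r u)\<^sup>2"
    and N: "N = (r u)\<^sup>2 + K\<^sup>2" "N = m\<^sup>2 * U\<^sup>2 * B\<^sup>2" and "m \<noteq> 0" "U \<noteq> 0"
    and arc: "r'\<^sup>2 / B\<^sup>2 + (r u)\<^sup>2 * \<zeta>'\<^sup>2 / N = 1"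
    and orth: "\<omega>' * N = - K * B * \<zeta>'"
  shows "first_fundamental_form \<kappa> \<tau> (\<lambda>(u, t). helicoid_param a r \<zeta> (u, t / m + \<omega> u))
      (u, t) (du, dt) (du', dt') = du * du' + U\<^sup>2 * (dt * dt')"
proof -
  \<comment> \<open>\<open>e\<close> is the squared length of the Killing field and \<open>k\<close>
    its inner product with the vertical field.\<close>
  define k e where "k = K / B" and "e = N / B\<^sup>2"
  define q where "q \<equiv> \<lambda>du dt. dt / m + \<omega>' * du"
  have N0: "N \<noteq> 0" using N(2) B(2) \<open>m \<noteq> 0\<close> \<open>U \<noteq> 0\<close> by simp
  have e: "e = m\<^sup>2 * U\<^sup>2" using N(2) B(2) by (simp add: e_def)
  have e2: "e = (r u)\<^sup>2 / B\<^sup>2 + k\<^sup>2" using N(1) by (simp add: e_def k_def power_divide add_divide_distrib)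
  then have e2': "(r u)\<^sup>2 / B\<^sup>2 = e - k\<^sup>2" by simp
  have e0: "e \<noteq> 0" using N0 B(2) by (simp add: e_def)
  have \<omega>': "\<omega>' * e = - k * \<zeta>'"
    using orth B(2) by (simp add: e_def k_def power2_eq_square divide_simps)
  \<comment> \<open>The arc length condition is rewritten as the unit length of the component of the
    \<open>u\<close>-curve orthogonal to the Killing field.\<close>
  have "(r u)\<^sup>2 * \<zeta>'\<^sup>2 / N = (r u)\<^sup>2 / B\<^sup>2 * \<zeta>'\<^sup>2 / e"
    using B(2) N0 by (simp add: e_def divide_simps)
  also have "\<dots> = \<zeta>'\<^sup>2 - (k * \<zeta>')\<^sup>2 / e"
    using e0 unfolding e2' by (simp add: field_simps power_mult_distrib)
  also have "(k * \<zeta>')\<^sup>2 / e = \<omega>'\<^sup>2 * e"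
  proof -
    have "(k * \<zeta>')\<^sup>2 = (\<omega>' * e)\<^sup>2" using \<omega>' by simp
    then show ?thesis using e0 by (simp add: power2_eq_square)
  qed
  finally have arc': "r'\<^sup>2 / B\<^sup>2 = 1 - \<zeta>'\<^sup>2 + \<omega>'\<^sup>2 * e" using arc by simp
  define x x' where "x = dt / m" and "x' = dt' / m"
  have xx: "e * x * x' = U\<^sup>2 * (dt * dt')"
    using \<open>m \<noteq> 0\<close> by (simp add: e x_def x'_def power2_eq_square)
  have D: "frechet_derivative (\<lambda>(u, t). helicoid_param a r \<zeta> (u, t / m + \<omega> u)) (at (u, t)) =
     (\<lambda>(du, dt). let q = dt / m + \<omega>' * du in
        (r' * du * cos (t / m + \<omega> u) - r u * sin (t / m + \<omega> u) * q,
         r' * du * sin (t / m + \<omega> u) + r u * cos (t / m + \<omega> u) * q, \<zeta>' * du + a * q))"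
    by (rule frechet_derivative_at[OF helicoid_param_has_derivative[OF r \<zeta> \<omega> refl], symmetric])
  have shift: "\<zeta>' * d + a * q - \<tau> * (r u)\<^sup>2 * q / B = \<zeta>' * d + k * q" for d q
    using B(2) by (simp add: k_def K field_simps)
  have "first_fundamental_form \<kappa> \<tau> (\<lambda>(u, t). helicoid_param a r \<zeta> (u, t / m + \<omega> u))
      (u, t) (du, dt) (du', dt')
    = (r' * du * (r' * du') + (r u)\<^sup>2 * q du dt * q du' dt') / B\<^sup>2
      + (\<zeta>' * du + k * q du dt) * (\<zeta>' * du' + k * q du' dt')"
    unfolding first_fundamental_form_def D
    by (simp add: Let_def helicoid_param_def bcv_metric_cylindrical[OF B(1)] shift q_def)
  also have "\<dots> = r'\<^sup>2 / B\<^sup>2 * (du * du') + (r u)\<^sup>2 / B\<^sup>2 * (q du dt * q du' dt')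
      + (\<zeta>' * du + k * q du dt) * (\<zeta>' * du' + k * q du' dt')"
    by (simp add: add_divide_distrib power2_eq_square mult_ac)
  also note e2'
  \<comment> \<open>By \<open>arc'\<close> and the orthogonality relation the coefficient of
    \<open>du * du'\<close> becomes \<open>1\<close> and the mixed terms cancel.\<close>
  also have "r'\<^sup>2 / B\<^sup>2 * (du * du') + (e - k\<^sup>2) * (q du dt * q du' dt')
      + (\<zeta>' * du + k * q du dt) * (\<zeta>' * du' + k * q du' dt') = du * du' + e * x * x'"
    unfolding arc' q_def x_def[symmetric] x'_def[symmetric] using \<omega>' by algebra
  finally show ?thesis using xx by simp
qed

lemma helicoid_param_has_natural_form:
  fixes r \<zeta> \<omega> :: "real \<Rightarrow> real"
  assumes "\<And>u. u \<in> J \<Longrightarrow> (r has_real_derivative r' u) (at u)"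
    "\<And>u. u \<in> J \<Longrightarrow> (\<zeta> has_real_derivative \<zeta>' u) (at u)"
    "\<And>u. u \<in> J \<Longrightarrow> (\<omega> has_real_derivative \<omega>' u) (at u)"
    "\<And>u. B u = bcv_B \<kappa> ((r u)\<^sup>2)" "\<And>u. u \<in> J \<Longrightarrow> B u \<noteq> 0"
    "\<And>u. K u = a * B u - \<tau> * (r u)\<^sup>2"
    "\<And>u. u \<in> J \<Longrightarrow> (r u)\<^sup>2 + (K u)\<^sup>2 = m\<^sup>2 * (U u)\<^sup>2 * (B u)\<^sup>2"
    "m \<noteq> 0" "\<And>u. u \<in> J \<Longrightarrow> U u \<noteq> 0"
    "\<And>u. u \<in> J \<Longrightarrow> (r' u)\<^sup>2 / (B u)\<^sup>2 + (r u)\<^sup>2 * (\<zeta>' u)\<^sup>2 / ((r u)\<^sup>2 + (K u)\<^sup>2) = 1"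
    "\<And>u. u \<in> J \<Longrightarrow> \<omega>' u * ((r u)\<^sup>2 + (K u)\<^sup>2) = - K u * B u * \<zeta>' u"
  shows "has_natural_form \<kappa> \<tau> (J \<times> UNIV) (\<lambda>(u, t). helicoid_param a r \<zeta> (u, t / m + \<omega> u)) U"
  unfolding has_natural_form_def
proof safe
  fix u t assume u: "u \<in> J"
  show "(\<lambda>(u, t). helicoid_param a r \<zeta> (u, t / m + \<omega> u)) differentiable at (u, t)"
    using helicoid_param_has_derivative[OF assms(1-3)[OF u] refl] by (auto simp: differentiable_def)
  show "first_fundamental_form \<kappa> \<tau> (\<lambda>(u, t). helicoid_param a r \<zeta> (u, t / m + \<omega> u))
      (u, t) (du, dt) (du', dt') = du * du' + (U u)\<^sup>2 * (dt * dt')" for du dt du' dt'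
    using assms u by (intro helicoid_param_first_fundamental_form[OF assms(1-3)[OF u] assms(4) _ assms(6)]) auto
qed

section \<open>Immersion, isometry, invariance and smoothness\<close>

text \<open>The form \<open>du^2 + U^2 dt^2\<close> is positive definite where \<open>U\<close> does
  not vanish, and a kernel vector of the differential has length zero in it.\<close>

lemma has_natural_form_imp_inj:
  assumes "has_natural_form \<kappa> \<tau> D X U" "(u, t) \<in> D" "U u \<noteq> 0"
  shows "inj (frechet_derivative X (at (u, t)))"
proof -
  have lin: "linear (frechet_derivative X (at (u, t)))"
    using assms(1,2) by (intro linear_frechet_derivative) (auto simp: has_natural_form_def)
  show ?thesis
    unfolding linear_injective_0[OF lin]
  proof safe
    fix du dt assume 0: "frechet_derivative X (at (u, t)) (du, dt) = 0"
    have "first_fundamental_form \<kappa> \<tau> X (u, t) (du, dt) (du, dt) = du * du + (U u)\<^sup>2 * (dt * dt)"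
      using assms(1,2) by (auto simp: has_natural_form_def)
    moreover have "first_fundamental_form \<kappa> \<tau> X (u, t) (du, dt) (du, dt) = 0"
      unfolding first_fundamental_form_def 0
      by (simp add: bcv_metric_def Let_def zero_prod_def split: prod.split)
    ultimately have "du\<^sup>2 + (U u * dt)\<^sup>2 = 0"
      by (simp add: power2_eq_square algebra_simps)
    then show "(du, dt) = 0" using assms(3) by (auto simp: sum_power2_eq_zero_iff zero_prod_def)
  qed
qed

lemma has_natural_form_imp_isometric:
  assumes "has_natural_form \<kappa> \<tau> D X U" "has_natural_form \<kappa> \<tau> D Y U"
  shows "isometric_on \<kappa> \<tau> D X Y"
  using assms unfolding has_natural_form_def isometric_on_def by fastforce

text \<open>A screw motion by \<open>s\<close> adds \<open>s\<close> to the angle, which amounts to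
  shifting \<open>t\<close> by \<open>m * s\<close>; the full line of values of \<open>t\<close>
  absorbs the shift.\<close>

lemma helicoid_param_screw_invariant:
  assumes "m \<noteq> 0" "X = (\<lambda>(u, t). helicoid_param a r \<zeta> (u, t / m + \<omega> u))"
  shows "screw_motion a s ` (X ` (J \<times> UNIV)) = X ` (J \<times> UNIV)"
proof -
  have sub: "screw_motion a s ` (X ` (J \<times> UNIV)) \<subseteq> X ` (J \<times> UNIV)" for s
  proof -
    have "screw_motion a s (X (u, t)) \<in> X ` (J \<times> UNIV)" if "u \<in> J" for u t
    proof -
    have T: "(t + m * s) / m + \<omega> u = (t / m + \<omega> u) + s"
      using assms(1) by (simp add: field_simps)
    have "screw_motion a s (helicoid_param a r \<zeta> (u, T)) = helicoid_param a r \<zeta> (u, T + s)" for T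
      by (simp add: screw_motion_def helicoid_param_def cylindrical_def cos_add sin_add algebra_simps)
    then have "screw_motion a s (X (u, t)) = X (u, t + m * s)"
      unfolding assms(2) case_prod_conv T .
    then show ?thesis using \<open>u \<in> J\<close> by auto
    qed
    then show ?thesis by auto
  qed
  \<comment> \<open>The motion by \<open>- s\<close> is undone by the motion by \<open>s\<close>, so
    \<open>sub\<close> for \<open>- s\<close> yields the opposite inclusion.\<close>
  have "screw_motion a s (screw_motion a (- s) p) = p" for p
  proof (cases p)
    case (fields x y z)
    have "sin s * sin s = 1 - cos s * cos s"
      using sin_cos_squared_add[of s] by (simp add: power2_eq_square)
    then show ?thesis unfolding fields screw_motion_def by simp algebra
  qed
  then have "X ` (J \<times> UNIV) \<subseteq> screw_motion a s ` (X ` (J \<times> UNIV))"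
    using sub[of "- s"] by (metis image_subset_iff rev_image_eqI subsetI)
  with sub show ?thesis by blast
qed

lemma helicoid_param_smooth:
  assumes J: "open J" and "smooth_on J r" "smooth_on J \<zeta>" "smooth_on J \<omega>" and "m \<noteq> 0"
  shows "smooth_on (J \<times> UNIV) (\<lambda>(u, t). helicoid_param a r \<zeta> (u, t / m + \<omega> u))"
proof -
  have o: "open (J \<times> (UNIV :: real set))" using J by (simp add: open_Times)
  have F: "smooth_on (J \<times> (UNIV :: real set)) (\<lambda>p. f (fst p))" if "smooth_on J f" for f :: "real \<Rightarrow> real"
    by (rule smooth_on_compose[OF that o smooth_on_linear[OF bounded_linear_fst]]) auto
  have T: "smooth_on (J \<times> UNIV) (\<lambda>p. snd p / m + \<omega> (fst p))"
    using \<open>m \<noteq> 0\<close> by (intro smooth_on_add smooth_on_divide smooth_on_linear[OF bounded_linear_snd]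
        smooth_on_const F o assms)
  have "smooth_on (J \<times> UNIV) (\<lambda>p. (r (fst p) * cos (snd p / m + \<omega> (fst p)),
      r (fst p) * sin (snd p / m + \<omega> (fst p)), \<zeta> (fst p) + a * (snd p / m + \<omega> (fst p))))"
    by (intro smooth_on_Pair smooth_on_mult smooth_on_add smooth_on_const F T o assms
        smooth_on_compose[OF smooth_on_sin_cos(1) o T] smooth_on_compose[OF smooth_on_sin_cos(2) o T]) auto
  then show ?thesis by (simp add: helicoid_param_def cylindrical_def case_prod_unfold)
qed

lemma helicoid_param_helicoidal:
  assumes "open J" "smooth_on J r" "smooth_on J \<zeta>" "smooth_on J \<omega>" "m \<noteq> 0"
    and X: "X = (\<lambda>(u, t). helicoid_param a r \<zeta> (u, t / m + \<omega> u))"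
    and B: "\<And>u. u \<in> J \<Longrightarrow> 0 < bcv_B \<kappa> ((r u)\<^sup>2)"
    and "has_natural_form \<kappa> \<tau> (J \<times> UNIV) X U" "\<And>u. u \<in> J \<Longrightarrow> U u \<noteq> 0"
  shows "helicoidal_surface \<kappa> a (J \<times> UNIV) X"
  unfolding helicoidal_surface_def
proof (intro conjI allI ballI)
  have "(r u * cos \<theta>)\<^sup>2 + (r u * sin \<theta>)\<^sup>2 = (r u)\<^sup>2" for u \<theta>
    by (simp add: power_mult_distrib flip: distrib_left)
  then show "X ` (J \<times> UNIV) \<subseteq> bcv_space \<kappa>"
    using B by (auto simp: X bcv_space_def helicoid_param_def cylindrical_def)
  show "smooth_on (J \<times> UNIV) X" unfolding X using assms by (intro helicoid_param_smooth)
  show "inj (frechet_derivative X (at p))" if "p \<in> J \<times> UNIV" for p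
    using that assms(8,9) has_natural_form_imp_inj by (cases p) blast
  show "screw_motion a s ` (X ` (J \<times> UNIV)) = X ` (J \<times> UNIV)" for s
    by (rule helicoid_param_screw_invariant[OF \<open>m \<noteq> 0\<close> X])
qed

section \<open>The explicit family\<close>

text \<open>The root \<open>(s - \<beta>) / (2 * \<alpha>)\<close> is taken in the rationalized form
  \<open>2 * D / (\<beta> + s)\<close>, which stays meaningful for \<open>\<alpha> = 0\<close>. The
  second conclusion is the derivative of the quadratic at this root.\<close>

lemma quadratic_root:
  fixes R s \<alpha> \<beta> D :: real
  assumes "s\<^sup>2 = \<beta>\<^sup>2 + 4 * \<alpha> * D" "R * (\<beta> + s) = 2 * D" "\<beta> + s \<noteq> 0" "R \<noteq> 0"
  shows "\<alpha> * R\<^sup>2 + \<beta> * R = D" "2 * \<alpha> * R + \<beta> = s"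
proof -
  have "(\<beta> + s)\<^sup>2 * (\<alpha> * R\<^sup>2 + \<beta> * R - D) = 0"
    using assms(1,2) by algebra
  then show *: "\<alpha> * R\<^sup>2 + \<beta> * R = D" using assms(3) by simp
  have "R * (2 * \<alpha> * R + \<beta> - s) = 0"
    using * assms(2) by (simp add: algebra_simps power2_eq_square)
  then show "2 * \<alpha> * R + \<beta> = s" using assms(4) by simp
qed

lemma bour_xi1_power2:
  assumes "0 < (m\<^sup>2 * (U u)\<^sup>2 - a\<^sup>2) / bour_denom \<kappa> \<tau> m a U u"
  shows "(bour_xi1 \<kappa> \<tau> m a U u)\<^sup>2 = 4 * ((m\<^sup>2 * (U u)\<^sup>2 - a\<^sup>2) / bour_denom \<kappa> \<tau> m a U u)"
    and "0 < bour_xi1 \<kappa> \<tau> m a U u"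
  using assms by (simp_all add: bour_xi1_def power_mult_distrib)

text \<open>Since \<open>B\<close> is affine in \<open>R\<close>, the first equation is quadratic in
  \<open>R\<close> with discriminant \<open>bour_Delta\<close>. The left side of the second is the
  derivative in \<open>R\<close> of the difference of its two sides, as needed for implicit
  differentiation.\<close>

lemma bour_xi1_quadratic:
  fixes \<kappa> \<tau> m a U u
  defines "R \<equiv> (bour_xi1 \<kappa> \<tau> m a U u)\<^sup>2"
  defines "W \<equiv> m\<^sup>2 * (U u)\<^sup>2"
  defines "B \<equiv> bcv_B \<kappa> R"
  assumes "0 < bour_Delta \<kappa> \<tau> m a U u" "bour_denom \<kappa> \<tau> m a U u \<noteq> 0"
    and "0 < (m\<^sup>2 * (U u)\<^sup>2 - a\<^sup>2) / bour_denom \<kappa> \<tau> m a U u"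
  shows "R + (a * B - \<tau> * R)\<^sup>2 = W * B\<^sup>2"
    and "1 + 2 * (a * B - \<tau> * R) * (a * \<kappa> / 4 - \<tau>) - W * B * \<kappa> / 2 = sqrt (bour_Delta \<kappa> \<tau> m a U u)"
proof -
  define s where "s = sqrt (bour_Delta \<kappa> \<tau> m a U u)"
  \<comment> \<open>Expanding the first claim in powers of \<open>R\<close> gives
    \<open>\<alpha> * R^2 + \<beta> * R = D\<close>.\<close>
  define D where "D = W - a\<^sup>2"
  define \<alpha> where "\<alpha> = (a * \<kappa> / 4 - \<tau>)\<^sup>2 - W * \<kappa>\<^sup>2 / 16"
  define \<beta> where "\<beta> = 1 - 2 * a * \<tau> - \<kappa> * D / 2"
  have s2: "s\<^sup>2 = (1 - 2 * a * \<tau>)\<^sup>2 + D * (4 * \<tau>\<^sup>2 - \<kappa>)"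
    using assms(4) by (simp add: s_def bour_Delta_def D_def W_def)
  have disc: "s\<^sup>2 = \<beta>\<^sup>2 + 4 * \<alpha> * D"
    unfolding s2 \<beta>_def \<alpha>_def D_def by (simp add: field_simps power2_eq_square)
  \<comment> \<open>Substituting the value of \<open>s^2\<close> linearizes the square in
    \<open>bour_denom\<close>, which turns \<open>R\<close> into the rationalized root.\<close>
  have dn: "bour_denom \<kappa> \<tau> m a U u = 2 * (\<beta> + s)"
  proof -
    have "bour_denom \<kappa> \<tau> m a U u = (1 + s)\<^sup>2 - 4 * \<tau>\<^sup>2 * W"
      by (simp add: bour_denom_def s_def W_def)
    also have "\<dots> = 1 + 2 * s + s\<^sup>2 - 4 * \<tau>\<^sup>2 * W" by (simp add: power2_eq_square algebra_simps)
    also have "\<dots> = 2 * (\<beta> + s)"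
      unfolding s2 \<beta>_def D_def by (simp add: field_simps power2_eq_square)
    finally show ?thesis .
  qed
  have bs: "\<beta> + s \<noteq> 0" using assms(5) dn by simp
  have R: "R = 4 * (D / (2 * (\<beta> + s)))"
    unfolding R_def bour_xi1_power2(1)[OF assms(6)] dn D_def W_def ..
  have RD: "R * (\<beta> + s) = 2 * D" using bs by (simp add: R field_simps)
  have R0: "R \<noteq> 0" using bour_xi1_power2(2)[OF assms(6)] by (simp add: R_def)
  note q = quadratic_root[OF disc RD bs R0]
  have "R + (a * B - \<tau> * R)\<^sup>2 - W * B\<^sup>2 = \<alpha> * R\<^sup>2 + \<beta> * R - D"
    unfolding \<alpha>_def \<beta>_def D_def B_def bcv_B_def by (simp add: field_simps power2_eq_square)
  with q(1) show "R + (a * B - \<tau> * R)\<^sup>2 = W * B\<^sup>2" by simp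
  have "1 + 2 * (a * B - \<tau> * R) * (a * \<kappa> / 4 - \<tau>) - W * B * \<kappa> / 2 = 2 * \<alpha> * R + \<beta>"
    unfolding \<alpha>_def \<beta>_def D_def B_def bcv_B_def by (simp add: field_simps power2_eq_square)
  with q(2) show "1 + 2 * (a * B - \<tau> * R) * (a * \<kappa> / 4 - \<tau>) - W * B * \<kappa> / 2
      = sqrt (bour_Delta \<kappa> \<tau> m a U u)" by (simp add: s_def)
qed

section \<open>Smoothness, admissibility and the derivative of the explicit formulas\<close>

lemma bour_regularity:
  assumes J: "open J" and U: "smooth_on J U"
    and \<Delta>: "\<And>u. u \<in> J \<Longrightarrow> 0 < bour_Delta \<kappa> \<tau> m a U u"
    and ratio: "\<And>u. u \<in> J \<Longrightarrow> 0 < (m\<^sup>2 * (U u)\<^sup>2 - a\<^sup>2) / bour_denom \<kappa> \<tau> m a U u"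
  shows smooth_on_bour_xi1: "smooth_on J (bour_xi1 \<kappa> \<tau> m a U)"
    and smooth_on_bour_radicand: "smooth_on J (bour_radicand \<kappa> \<tau> m a U)"
proof -
  \<comment> \<open>Division by zero gives \<open>0\<close>, so a positive quotient has a nonzero
    denominator.\<close>
  have d: "bour_denom \<kappa> \<tau> m a U u \<noteq> 0" if "u \<in> J" for u
    using ratio[OF that] by auto
  have 1: "smooth_on J (bour_Delta \<kappa> \<tau> m a U)"
    unfolding bour_Delta_def[abs_def] by (intro smooth_on_add smooth_on_diff smooth_on_mult smooth_on_power smooth_on_const J U)
  have 2: "smooth_on J (bour_denom \<kappa> \<tau> m a U)"
    unfolding bour_denom_def[abs_def]
    by (intro smooth_on_add smooth_on_diff smooth_on_mult smooth_on_power smooth_on_const smooth_on_sqrt J U 1 \<Delta>)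
  show 3: "smooth_on J (bour_xi1 \<kappa> \<tau> m a U)"
    unfolding bour_xi1_def[abs_def]
    by (intro smooth_on_diff smooth_on_mult smooth_on_power smooth_on_const smooth_on_sqrt
        smooth_on_divide J U 1 2 d ratio)
  show "smooth_on J (bour_radicand \<kappa> \<tau> m a U)"
    unfolding bour_radicand_def[abs_def]
    by (intro smooth_on_add smooth_on_diff smooth_on_mult smooth_on_power smooth_on_const
        smooth_on_divide J U 1 3 smooth_on_deriv)
      (use \<Delta> in force)
qed

text \<open>A strictly positive radicand has a smooth root, so admissibility follows from
  \<open>m \<noteq> 0\<close> and strict inequalities, which survive small changes of
  \<open>u\<close>, \<open>m\<close> and \<open>a\<close>.\<close>

lemma bour_admissibleI:
  assumes "open J" "smooth_on J U" "m \<noteq> 0"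
    and "\<And>u. u \<in> J \<Longrightarrow> 0 < bour_Delta \<kappa> \<tau> m a U u"
    and "\<And>u. u \<in> J \<Longrightarrow> 0 < (m\<^sup>2 * (U u)\<^sup>2 - a\<^sup>2) / bour_denom \<kappa> \<tau> m a U u"
    and "\<And>u. u \<in> J \<Longrightarrow> 0 < 4 + \<kappa> * (bour_xi1 \<kappa> \<tau> m a U u)\<^sup>2"
    and "\<And>u. u \<in> J \<Longrightarrow> 0 < bour_radicand \<kappa> \<tau> m a U u"
  shows "bour_admissible \<kappa> \<tau> J U m a"
proof -
  have "smooth_on J (\<lambda>u. sqrt (bour_radicand \<kappa> \<tau> m a U u))"
    by (intro smooth_on_sqrt smooth_on_bour_radicand assms)
  moreover have "bour_denom \<kappa> \<tau> m a U u \<noteq> 0" if "u \<in> J" for u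
    using assms(5)[OF that] by auto
  ultimately show ?thesis
    using assms(3-7) by (simp add: bour_admissible_def less_imp_le)
qed

lemma bour_admissible_subset:
  "bour_admissible \<kappa> \<tau> S U m a \<Longrightarrow> T \<subseteq> S \<Longrightarrow> bour_admissible \<kappa> \<tau> T U m a"
  unfolding bour_admissible_def using smooth_on_subset by blast

lemma bour_integrands_smooth:
  assumes J: "open J" and U: "smooth_on J U" "\<And>u. u \<in> J \<Longrightarrow> 0 < U u"
    and adm: "bour_admissible \<kappa> \<tau> J U m a"
  shows "smooth_on J (bour_xi2_integrand \<kappa> \<tau> m a U)"
    and "smooth_on J (bour_theta_integrand \<kappa> \<tau> m a U)"
proof -
  have s: "smooth_on J (bour_xi1 \<kappa> \<tau> m a U)"
    "smooth_on J (\<lambda>u. sqrt (bour_radicand \<kappa> \<tau> m a U u))"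
    using adm J U by (auto simp: bour_admissible_def intro!: smooth_on_bour_xi1)
  have "0 < bour_xi1 \<kappa> \<tau> m a U u" if "u \<in> J" for u
    using adm that bour_xi1_power2(2) by (simp add: bour_admissible_def)
  then have nz: "4 * (bour_xi1 \<kappa> \<tau> m a U u)\<^sup>2 \<noteq> 0"
    "4 * m * U u * (bour_xi1 \<kappa> \<tau> m a U u)\<^sup>2 \<noteq> 0" if "u \<in> J" for u
    using that U(2)[OF that] adm by (force simp: bour_admissible_def)+
  show "smooth_on J (bour_xi2_integrand \<kappa> \<tau> m a U)"
    unfolding bour_xi2_integrand_def[abs_def]
    by (intro smooth_on_mult smooth_on_divide smooth_on_add smooth_on_power smooth_on_const J U s nz)
  show "smooth_on J (bour_theta_integrand \<kappa> \<tau> m a U)"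
    unfolding bour_theta_integrand_def[abs_def]
    by (intro smooth_on_mult smooth_on_divide smooth_on_diff smooth_on_power smooth_on_const J U s nz)
qed

text \<open>Implicit differentiation of the quadratic equation for \<open>\<xi>\<^sub>1\<^sup>2\<close>.\<close>

lemma bour_xi1_has_derivative:
  fixes \<kappa> \<tau> m a U
  defines "r \<equiv> bour_xi1 \<kappa> \<tau> m a U"
  assumes J: "open J" and U: "smooth_on J U" and u: "u \<in> J"
    and adm: "bour_admissible \<kappa> \<tau> J U m a"
  shows "(r has_real_derivative m\<^sup>2 * U u * deriv U u * (bcv_B \<kappa> ((r u)\<^sup>2))\<^sup>2
            / (r u * sqrt (bour_Delta \<kappa> \<tau> m a U u))) (at u)"
proof -
  define s where "s = sqrt (bour_Delta \<kappa> \<tau> m a U u)"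
  define R where "R = (\<lambda>u. (r u)\<^sup>2)"
  define B where "B = (\<lambda>u. bcv_B \<kappa> (R u))"
  have A: "0 < bour_Delta \<kappa> \<tau> m a U v" "bour_denom \<kappa> \<tau> m a U v \<noteq> 0"
    "0 < (m\<^sup>2 * (U v)\<^sup>2 - a\<^sup>2) / bour_denom \<kappa> \<tau> m a U v" if "v \<in> J" for v
    using adm that by (auto simp: bour_admissible_def)
  have r0: "0 < r u" and s0: "0 < s"
    using bour_xi1_power2(2)[OF A(3)[OF u]] A(1)[OF u] by (simp_all add: r_def s_def)
  \<comment> \<open>The explicit formula shows that a derivative exists; its value is then read off
    from the quadratic equation.\<close>
  define r' where "r' = deriv r u"
  have r': "(r has_real_derivative r') (at u)"
    unfolding r'_def
    by (rule smooth_on_has_real_derivative[OF _ u]) (unfold r_def, intro smooth_on_bour_xi1 J U A)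
  define U' where "U' = deriv U u"
  have U': "(U has_real_derivative U') (at u)"
    unfolding U'_def by (rule smooth_on_has_real_derivative[OF U u])
  have R': "(R has_real_derivative 2 * r u * r') (at u)"
    unfolding R_def by (auto intro!: derivative_eq_intros r')
  have B': "(B has_real_derivative \<kappa> / 4 * (2 * r u * r')) (at u)"
    unfolding B_def bcv_B_def by (auto intro!: derivative_eq_intros R')
  have q: "R v + (a * B v - \<tau> * R v)\<^sup>2 - m\<^sup>2 * (U v)\<^sup>2 * (B v)\<^sup>2 = 0" if "v \<in> J" for v
    using bour_xi1_quadratic(1)[OF A[OF that]] by (simp add: R_def B_def r_def)
  have "((\<lambda>v. R v + (a * B v - \<tau> * R v)\<^sup>2 - m\<^sup>2 * (U v)\<^sup>2 * (B v)\<^sup>2) has_real_derivative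
      2 * r u * r' * (1 + 2 * (a * B u - \<tau> * R u) * (a * \<kappa> / 4 - \<tau>) - m\<^sup>2 * (U u)\<^sup>2 * B u * \<kappa> / 2)
      - 2 * m\<^sup>2 * U u * U' * (B u)\<^sup>2) (at u)"
    by (auto intro!: derivative_eq_intros R' B' U' simp: algebra_simps power2_eq_square)
  moreover have "((\<lambda>v. R v + (a * B v - \<tau> * R v)\<^sup>2 - m\<^sup>2 * (U v)\<^sup>2 * (B v)\<^sup>2) has_real_derivative 0) (at u)"
    by (rule has_field_derivative_transform_within_open[OF DERIV_const J u]) (simp add: q)
  ultimately have E: "2 * r u * r' * (1 + 2 * (a * B u - \<tau> * R u) * (a * \<kappa> / 4 - \<tau>) - m\<^sup>2 * (U u)\<^sup>2 * B u * \<kappa> / 2)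
      - 2 * m\<^sup>2 * U u * U' * (B u)\<^sup>2 = 0"
    by (rule DERIV_unique)
  have "1 + 2 * (a * B u - \<tau> * R u) * (a * \<kappa> / 4 - \<tau>) - m\<^sup>2 * (U u)\<^sup>2 * B u * \<kappa> / 2 = s"
    using bour_xi1_quadratic(2)[OF A[OF u]] by (simp add: R_def B_def r_def s_def)
  from E[unfolded this] have "r' = m\<^sup>2 * U u * U' * (B u)\<^sup>2 / (r u * s)"
    using r0 s0 by (simp add: field_simps)
  with r' show ?thesis by (simp add: B_def R_def s_def U'_def)
qed

section \<open>Geometry and existence of the explicit surfaces\<close>

lemma bour_surface_properties:
  assumes J: "open J" and U: "smooth_on J U" "\<And>u. u \<in> J \<Longrightarrow> 0 < U u"
    and X: "bour_surface \<kappa> \<tau> J U m a X"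
  shows bour_surface_has_natural_form: "has_natural_form \<kappa> \<tau> (J \<times> UNIV) X U"
    and bour_surface_helicoidal: "helicoidal_surface \<kappa> a (J \<times> UNIV) X"
proof -
  define r where "r = bour_xi1 \<kappa> \<tau> m a U"
  define s where "s = (\<lambda>u. sqrt (bour_Delta \<kappa> \<tau> m a U u))"
  define B where "B = (\<lambda>u. bcv_B \<kappa> ((r u)\<^sup>2))"
  define K where "K = (\<lambda>u. a * B u - \<tau> * (r u)\<^sup>2)"
  define Q where "Q = bour_radicand \<kappa> \<tau> m a U"
  define r' where "r' = (\<lambda>u. m\<^sup>2 * U u * deriv U u * (B u)\<^sup>2 / (r u * s u))"
  obtain \<xi>2 \<omega> where adm: "bour_admissible \<kappa> \<tau> J U m a"
    and \<xi>2: "\<And>u. u \<in> J \<Longrightarrow> (\<xi>2 has_real_derivative bour_xi2_integrand \<kappa> \<tau> m a U u) (at u)"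
    and \<omega>: "\<And>u. u \<in> J \<Longrightarrow> (\<omega> has_real_derivative bour_theta_integrand \<kappa> \<tau> m a U u) (at u)"
    and X_eq: "X = (\<lambda>(u, t). helicoid_param a r \<xi>2 (u, t / m + \<omega> u))"
    using X unfolding bour_surface_def r_def by blast
  have A: "0 < bour_Delta \<kappa> \<tau> m a U u" "bour_denom \<kappa> \<tau> m a U u \<noteq> 0"
    "0 < (m\<^sup>2 * (U u)\<^sup>2 - a\<^sup>2) / bour_denom \<kappa> \<tau> m a U u" "0 \<le> Q u" if "u \<in> J" for u
    using adm that by (auto simp: bour_admissible_def Q_def)
  have m: "m \<noteq> 0" using adm by (simp add: bour_admissible_def)
  have B0: "0 < B u" if "u \<in> J" for u
  proof -
    have "0 < 4 + \<kappa> * (r u)\<^sup>2" using adm that by (simp add: bour_admissible_def r_def)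
    then show ?thesis by (simp add: B_def bcv_B_def)
  qed
  have r0: "0 < r u" and s0: "0 < s u" if "u \<in> J" for u
    using bour_xi1_power2(2)[OF A(3)[OF that]] A(1)[OF that] by (simp_all add: r_def s_def)
  have B4: "4 + \<kappa> * (bour_xi1 \<kappa> \<tau> m a U u)\<^sup>2 = 4 * B u" for u
    by (simp add: B_def bcv_B_def r_def)
  have N: "(r u)\<^sup>2 + (K u)\<^sup>2 = m\<^sup>2 * (U u)\<^sup>2 * (B u)\<^sup>2" if "u \<in> J" for u
    using bour_xi1_quadratic(1)[OF A(1-3)[OF that]] by (simp add: r_def B_def K_def)
  have \<xi>2': "bour_xi2_integrand \<kappa> \<tau> m a U u = m * U u * B u / (r u)\<^sup>2 * sqrt (Q u)" for u
    unfolding bour_xi2_integrand_def B4 Q_def r_def by simp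
  have \<omega>': "bour_theta_integrand \<kappa> \<tau> m a U u = - K u / (m * U u * (r u)\<^sup>2) * sqrt (Q u)" for u
  proof -
    have "(4 * \<tau> - a * \<kappa>) * (r u)\<^sup>2 - 4 * a = 4 * - K u"
      by (simp add: K_def B_def bcv_B_def algebra_simps)
    then show ?thesis
      unfolding bour_theta_integrand_def r_def[symmetric] Q_def[symmetric] by simp
  qed
  \<comment> \<open>The square of \<open>r'\<close> brings in \<open>(s u)^2\<close>, which is the
    \<open>bour_Delta\<close> in the denominator of the radicand.\<close>
  have Q_eq: "Q u = (r u)\<^sup>2 - (r u)\<^sup>2 * (r' u)\<^sup>2 / (B u)\<^sup>2" if "u \<in> J" for u
  proof -
    have "(s u)\<^sup>2 = bour_Delta \<kappa> \<tau> m a U u" using A(1)[OF that] by (simp add: s_def)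
    then have "Q u = (r u)\<^sup>2 - m ^ 4 * (U u)\<^sup>2 * (deriv U u)\<^sup>2 * (4 * B u)\<^sup>2 / (16 * (s u)\<^sup>2)"
      unfolding Q_def bour_radicand_def B4 r_def by simp
    also have "m ^ 4 * (U u)\<^sup>2 * (deriv U u)\<^sup>2 * (4 * B u)\<^sup>2 / (16 * (s u)\<^sup>2)
        = (r u)\<^sup>2 * (r' u)\<^sup>2 / (B u)\<^sup>2"
      using r0[OF that] s0[OF that] B0[OF that]
      by (simp add: r'_def field_simps power2_eq_square power4_eq_xxxx)
    finally show ?thesis .
  qed
  show nf: "has_natural_form \<kappa> \<tau> (J \<times> UNIV) X U"
    unfolding X_eq
  proof (rule helicoid_param_has_natural_form[where B = B and K = K, OF _ \<xi>2 \<omega>])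
    fix u assume u: "u \<in> J"
    show "(r has_real_derivative r' u) (at u)"
      using bour_xi1_has_derivative[OF J U(1) u adm] by (simp add: r_def r'_def B_def s_def)
    have pos: "r u \<noteq> 0" "B u \<noteq> 0" "U u \<noteq> 0" using r0[OF u] B0[OF u] U(2)[OF u] by auto
    \<comment> \<open>Here the nonnegativity of the radicand enters.\<close>
    have sq: "sqrt (Q u) * sqrt (Q u) = Q u" using A(4)[OF u] by simp
    have "(r u)\<^sup>2 * (bour_xi2_integrand \<kappa> \<tau> m a U u)\<^sup>2 / (m\<^sup>2 * (U u)\<^sup>2 * (B u)\<^sup>2)
        = (sqrt (Q u) * sqrt (Q u)) / (r u)\<^sup>2"
      unfolding \<xi>2' using pos m by (simp add: power2_eq_square)
    also have "\<dots> = Q u / (r u)\<^sup>2" by (simp only: sq)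
    also have "\<dots> = 1 - (r' u)\<^sup>2 / (B u)\<^sup>2"
      unfolding Q_eq[OF u] using pos by (simp add: field_simps)
    finally show "(r' u)\<^sup>2 / (B u)\<^sup>2 + (r u)\<^sup>2 * (bour_xi2_integrand \<kappa> \<tau> m a U u)\<^sup>2
        / ((r u)\<^sup>2 + (K u)\<^sup>2) = 1"
      unfolding N[OF u] by simp
    \<comment> \<open>Both integrands carry the same root; each side equals
      \<open>- K * m * U * B^2 * sqrt Q / r^2\<close>.\<close>
    show "bour_theta_integrand \<kappa> \<tau> m a U u * ((r u)\<^sup>2 + (K u)\<^sup>2)
        = - K u * B u * bour_xi2_integrand \<kappa> \<tau> m a U u"
      unfolding N[OF u] \<xi>2' \<omega>' using pos m by (simp add: field_simps power2_eq_square)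
  qed (use B0 U(2) N m in \<open>force simp: B_def K_def\<close>)+
  show "helicoidal_surface \<kappa> a (J \<times> UNIV) X"
  proof (rule helicoid_param_helicoidal[OF J _ _ _ m X_eq _ nf])
    show "smooth_on J r" unfolding r_def by (intro smooth_on_bour_xi1 J U A)
    show "smooth_on J \<xi>2" "smooth_on J \<omega>"
      by (rule smooth_on_antiderivative[OF J bour_integrands_smooth(1)[OF J U adm] \<xi>2],
          assumption, assumption)
         (rule smooth_on_antiderivative[OF J bour_integrands_smooth(2)[OF J U adm] \<omega>],
          assumption, assumption)
  qed (use B0 U(2) in \<open>force simp: B_def\<close>)+
qed

text \<open>The integrands are continuous on the whole closed interval, hence have antiderivatives
  on its interior.\<close>

lemma bour_surface_exists:
  assumes S: "open S" "{l..r} \<subseteq> S" and U: "smooth_on S U" "\<And>u. u \<in> S \<Longrightarrow> 0 < U u"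
    and adm: "bour_admissible \<kappa> \<tau> S U m a"
  shows "\<exists>X. bour_surface \<kappa> \<tau> {l<..<r} U m a X"
proof -
  have c: "continuous_on {l..r} (bour_xi2_integrand \<kappa> \<tau> m a U)"
    "continuous_on {l..r} (bour_theta_integrand \<kappa> \<tau> m a U)"
    using bour_integrands_smooth[OF S(1) U adm] S(2) smooth_on_continuous continuous_on_subset
    by blast+
  obtain \<xi>2 \<omega> where
    "\<And>u. u \<in> {l<..<r} \<Longrightarrow> (\<xi>2 has_real_derivative bour_xi2_integrand \<kappa> \<tau> m a U u) (at u)"
    "\<And>u. u \<in> {l<..<r} \<Longrightarrow> (\<omega> has_real_derivative bour_theta_integrand \<kappa> \<tau> m a U u) (at u)"
    using real_antiderivative[OF c(1)] real_antiderivative[OF c(2)] by metis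
  moreover have "{l<..<r} \<subseteq> S" using S(2) by auto
  then have "bour_admissible \<kappa> \<tau> {l<..<r} U m a"
    using bour_admissible_subset[OF adm] by blast
  ultimately show ?thesis unfolding bour_surface_def by blast
qed

section \<open>Admissible parameters near a rotation surface\<close>

lemma eventually_pos_nhds:
  fixes f :: "'a::t2_space \<Rightarrow> real"
  assumes "isCont f x" "0 < f x"
  shows "eventually (\<lambda>y. 0 < f y) (nhds x)"
  using assms order_tendstoD(1) tendsto_at_iff_tendsto_nhds unfolding isCont_def by blast

text \<open>For \<open>a = 0\<close> both the squared radius and the radicand vanish to second order
  as \<open>m\<close> tends to \<open>0\<close>. Divided by \<open>m^2\<close> they have the
  positive limit \<open>U^2\<close>, so they are positive for small
  \<open>m \<noteq> 0\<close>.\<close>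

lemma bour_conditions_small_m:
  fixes U :: "real \<Rightarrow> real"
  assumes "0 < U u"
  shows "\<exists>m. m \<noteq> 0 \<and> 0 < bour_Delta \<kappa> \<tau> m 0 U u
    \<and> 0 < (m\<^sup>2 * (U u)\<^sup>2 - 0\<^sup>2) / bour_denom \<kappa> \<tau> m 0 U u
    \<and> 0 < 4 + \<kappa> * (bour_xi1 \<kappa> \<tau> m 0 U u)\<^sup>2 \<and> 0 < bour_radicand \<kappa> \<tau> m 0 U u"
proof -
  define \<Delta> where "\<Delta> = (\<lambda>m. bour_Delta \<kappa> \<tau> m 0 U u)"
  define d where "d = (\<lambda>m. bour_denom \<kappa> \<tau> m 0 U u)"
  \<comment> \<open>\<open>g\<close> and \<open>\<rho>\<close> are the squared radius and the
    radicand divided by \<open>m^2\<close>, in a form that is continuous at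
    \<open>m = 0\<close>.\<close>
  define g where "g = (\<lambda>m. 4 * (U u)\<^sup>2 / d m)"
  define c where "c = (\<lambda>m. 4 + \<kappa> * (m\<^sup>2 * g m))"
  define \<rho> where "\<rho> = (\<lambda>m. g m - m\<^sup>2 * (U u)\<^sup>2 * (deriv U u)\<^sup>2 * (c m)\<^sup>2 / (16 * \<Delta> m))"
  have v: "\<Delta> 0 = 1" "d 0 = 4" "g 0 = (U u)\<^sup>2" "c 0 = 4" "\<rho> 0 = (U u)\<^sup>2"
    by (simp_all add: \<Delta>_def bour_Delta_def d_def bour_denom_def g_def c_def \<rho>_def)
  have 1: "isCont \<Delta> 0" unfolding \<Delta>_def bour_Delta_def by (intro continuous_intros)
  have 2: "isCont d 0" unfolding d_def bour_denom_def \<Delta>_def[symmetric]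
    by (intro continuous_intros 1[unfolded \<Delta>_def])
  have 3: "isCont g 0" unfolding g_def by (intro continuous_intros 2) (simp add: v)
  have 4: "isCont c 0" unfolding c_def by (intro continuous_intros 3)
  have 5: "isCont \<rho> 0" unfolding \<rho>_def by (intro continuous_intros 1 3 4) (simp add: v)
  have "eventually (\<lambda>m. 0 < \<Delta> m \<and> 0 < d m \<and> 0 < c m \<and> 0 < \<rho> m) (nhds 0)"
    using assms by (intro eventually_conj eventually_pos_nhds 1 2 4 5) (simp_all add: v)
  then have "eventually (\<lambda>m. m \<noteq> 0 \<and> 0 < \<Delta> m \<and> 0 < d m \<and> 0 < c m \<and> 0 < \<rho> m) (at 0)"
    by (auto simp: eventually_at_filter elim: eventually_mono)
  then obtain m where m: "m \<noteq> 0" "0 < \<Delta> m" "0 < d m" "0 < c m" "0 < \<rho> m"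
    using eventually_happens'[OF trivial_limit_at] by blast
  have ratio: "0 < (m\<^sup>2 * (U u)\<^sup>2 - 0\<^sup>2) / bour_denom \<kappa> \<tau> m 0 U u"
    using m(1,3) assms by (simp add: d_def)
  have x: "(bour_xi1 \<kappa> \<tau> m 0 U u)\<^sup>2 = m\<^sup>2 * g m"
    unfolding bour_xi1_power2(1)[OF ratio] by (simp add: g_def d_def)
  have "bour_radicand \<kappa> \<tau> m 0 U u = m\<^sup>2 * \<rho> m"
    unfolding bour_radicand_def x \<rho>_def
    by (simp add: c_def \<Delta>_def algebra_simps power2_eq_square power4_eq_xxxx)
  then show ?thesis
    using m ratio x by (intro exI[of _ m]) (simp add: \<Delta>_def c_def)
qed

text \<open>All conditions are strict inequalities between functions of \<open>(u, m, a)\<close>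
  continuous at \<open>(u0, m0, 0)\<close>, so they hold on a neighbourhood of that point.\<close>

lemma bour_admissible_near:
  assumes I: "open I" "u0 \<in> I" and U: "smooth_on I U" "0 < U u0"
  obtains A P m where "open A" "u0 \<in> A" "A \<subseteq> I" "open P" "(m, 0) \<in> P"
    "\<And>m a. (m, a) \<in> P \<Longrightarrow> bour_admissible \<kappa> \<tau> A U m a"
proof -
  define \<Delta> where "\<Delta> = (\<lambda>(u, m, a). bour_Delta \<kappa> \<tau> m a U u)"
  define d where "d = (\<lambda>(u, m, a). bour_denom \<kappa> \<tau> m a U u)"
  define \<delta> where "\<delta> = (\<lambda>(u, m, a). (m\<^sup>2 * (U u)\<^sup>2 - a\<^sup>2) / bour_denom \<kappa> \<tau> m a U u)"
  define x where "x = (\<lambda>(u, m, a). bour_xi1 \<kappa> \<tau> m a U u)"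
  define \<rho> where "\<rho> = (\<lambda>(u, m, a). bour_radicand \<kappa> \<tau> m a U u)"
  obtain m0 where m0: "m0 \<noteq> 0" and
    pos: "0 < \<Delta> (u0, m0, 0)" "0 < \<delta> (u0, m0, 0)" "0 < 4 + \<kappa> * (x (u0, m0, 0))\<^sup>2" "0 < \<rho> (u0, m0, 0)"
    using bour_conditions_small_m[of U u0, OF U(2)] unfolding \<Delta>_def \<delta>_def x_def \<rho>_def by force
  define p where "p = (u0, m0, 0 :: real)"
  have d0: "d p \<noteq> 0" using pos(2) by (auto simp: d_def \<delta>_def p_def)
  have cont: "isCont f u0" if "smooth_on I f" for f :: "real \<Rightarrow> real"
    using smooth_on_continuous[OF that] I by (simp add: continuous_on_eq_continuous_at)
  have C: "isCont (\<lambda>q. f (fst q)) p" if "smooth_on I f" for f :: "real \<Rightarrow> real"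
    using cont[OF that] by (intro isCont_o2[where f = fst and g = f] continuous_intros) (simp add: p_def)
  note CU = C[OF U(1)] and CU' = C[OF smooth_on_deriv[OF I(1) U(1)]]
  have 1: "isCont \<Delta> p"
    unfolding \<Delta>_def case_prod_unfold bour_Delta_def by (intro continuous_intros CU)
  have 2: "isCont d p"
    unfolding d_def case_prod_unfold bour_denom_def
    by (intro continuous_intros CU 1[unfolded \<Delta>_def case_prod_unfold])
  have 3: "isCont \<delta> p"
    unfolding \<delta>_def case_prod_unfold
    by (intro continuous_intros CU 2[unfolded d_def case_prod_unfold])
       (use d0 in \<open>simp add: d_def p_def\<close>)
  have 4: "isCont x p"
    unfolding x_def case_prod_unfold bour_xi1_def
    by (intro continuous_intros 3[unfolded \<delta>_def case_prod_unfold])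
  have 5: "isCont \<rho> p"
    unfolding \<rho>_def case_prod_unfold bour_radicand_def
    by (intro continuous_intros CU CU' 4[unfolded x_def case_prod_unfold]
        1[unfolded \<Delta>_def case_prod_unfold])
       (use pos(1) in \<open>simp add: \<Delta>_def p_def\<close>)
  have 6: "isCont (\<lambda>q. 4 + \<kappa> * (x q)\<^sup>2) p" by (intro continuous_intros 4)
  \<comment> \<open>Squaring puts \<open>m \<noteq> 0\<close> into the same form as the other
    conditions.\<close>
  have 7: "isCont (\<lambda>q. (fst (snd q))\<^sup>2) p" by (intro continuous_intros)
  have "eventually (\<lambda>q. 0 < (fst (snd q))\<^sup>2 \<and> 0 < \<Delta> q \<and> 0 < \<delta> q \<and> 0 < 4 + \<kappa> * (x q)\<^sup>2 \<and> 0 < \<rho> q) (nhds p)"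
    using pos m0 by (intro eventually_conj eventually_pos_nhds 1 3 5 6 7) (simp_all add: p_def)
  then obtain S where S: "open S" "p \<in> S" and cond: "\<And>q. q \<in> S \<Longrightarrow>
      0 < (fst (snd q))\<^sup>2 \<and> 0 < \<Delta> q \<and> 0 < \<delta> q \<and> 0 < 4 + \<kappa> * (x q)\<^sup>2 \<and> 0 < \<rho> q"
    unfolding eventually_nhds by blast
  \<comment> \<open>A product neighbourhood separates \<open>u\<close> from the parameters: one set
    \<open>A\<close> serves every \<open>(m, a)\<close> in \<open>P\<close>.\<close>
  obtain A P where AP: "open A" "open P" "p \<in> A \<times> P" "A \<times> P \<subseteq> S"
    using open_prod_elim[OF S] by blast
  show thesis
  proof (rule that)
    show "open (A \<inter> I)" "u0 \<in> A \<inter> I" "A \<inter> I \<subseteq> I" "open P" "(m0, 0) \<in> P"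
      using AP I by (auto simp: p_def)
    fix m a assume "(m, a) \<in> P"
    then have "(u, m, a) \<in> S" if "u \<in> A \<inter> I" for u using that AP(4) by auto
    from cond[OF this] show "bour_admissible \<kappa> \<tau> (A \<inter> I) U m a"
      using AP(3) I AP(1) U(1)
      by (intro bour_admissibleI)
        (auto simp: p_def \<Delta>_def \<delta>_def x_def \<rho>_def intro: smooth_on_subset)
  qed
qed

section \<open>The family isometric to a given surface\<close>

text \<open>\<open>U\<close> is the length of the Killing field, and \<open>\<eta>\<close> is the
  rate at which the angle must be shifted along the profile to make the \<open>u\<close>-curves
  orthogonal to the orbits. The shift \<open>h\<close> may be any antiderivative on any
  \<open>J\<close> inside \<open>I\<close>, since the interval is fixed only later.\<close>

lemma helicoidal_surface_natural_parameters:
  assumes I: "open I" and \<xi>: "smooth_on I \<xi>1" "smooth_on I \<xi>2"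
    and pos: "\<And>u. u \<in> I \<Longrightarrow> 0 < \<xi>1 u" "\<And>u. u \<in> I \<Longrightarrow> 0 < bcv_B \<kappa> ((\<xi>1 u)\<^sup>2)"
    and arc: "arc_length_profile \<kappa> \<tau> a I \<xi>1 \<xi>2"
  obtains U \<eta> where "smooth_on I U" "\<And>u. u \<in> I \<Longrightarrow> 0 < U u" "smooth_on I \<eta>"
    "\<And>J h. J \<subseteq> I \<Longrightarrow> (\<And>u. u \<in> J \<Longrightarrow> (h has_real_derivative \<eta> u) (at u)) \<Longrightarrow>
       has_natural_form \<kappa> \<tau> (J \<times> UNIV) (\<lambda>(u, t). helicoid_param a \<xi>1 \<xi>2 (u, t + h u)) U"
proof -
  define B where "B = (\<lambda>u. bcv_B \<kappa> ((\<xi>1 u)\<^sup>2))"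
  define K where "K = (\<lambda>u. a * B u - \<tau> * (\<xi>1 u)\<^sup>2)"
  define N where "N = (\<lambda>u. (\<xi>1 u)\<^sup>2 + (K u)\<^sup>2)"
  define U where "U = (\<lambda>u. sqrt (N u) / B u)"
  \<comment> \<open>The difference \<open>0 - K u\<close> has the shape of the closure rule
    \<open>smooth_on_diff\<close>.\<close>
  define \<eta> where "\<eta> = (\<lambda>u. (0 - K u) * B u * deriv \<xi>2 u / N u)"
  have B0: "0 < B u" and N0: "0 < N u" if "u \<in> I" for u
    using pos(1)[OF that] pos(2)[OF that] by (simp_all add: B_def N_def add_pos_nonneg)
  then have nz: "B u \<noteq> 0" "N u \<noteq> 0" if "u \<in> I" for u using that by force+
  have 1: "smooth_on I B" unfolding B_def bcv_B_def
    by (intro smooth_on_add smooth_on_mult smooth_on_const smooth_on_power I \<xi>)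
  have 2: "smooth_on I K" unfolding K_def
    by (intro smooth_on_diff smooth_on_mult smooth_on_const smooth_on_power I \<xi> 1)
  have 3: "smooth_on I N" unfolding N_def by (intro smooth_on_add smooth_on_power I \<xi> 2)
  show thesis
  proof (rule that)
    show "smooth_on I U" unfolding U_def
      by (intro smooth_on_divide smooth_on_sqrt I 1 3 N0 nz)
    show "smooth_on I \<eta>" unfolding \<eta>_def
      by (intro smooth_on_divide smooth_on_mult smooth_on_diff smooth_on_const smooth_on_deriv I 1 2 3 \<xi> nz)
    show "0 < U u" if "u \<in> I" for u using N0[OF that] B0[OF that] by (simp add: U_def)
    fix J h assume J: "J \<subseteq> I" and h: "\<And>u. u \<in> J \<Longrightarrow> (h has_real_derivative \<eta> u) (at u)"
    \<comment> \<open>The given surface is the case \<open>m = 1\<close>.\<close>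
    have "has_natural_form \<kappa> \<tau> (J \<times> UNIV) (\<lambda>(u, t). helicoid_param a \<xi>1 \<xi>2 (u, t / 1 + h u)) U"
    proof (rule helicoid_param_has_natural_form[where B = B and K = K, OF _ _ h])
      fix u assume "u \<in> J"
      with J have u: "u \<in> I" by blast
      have Nf: "(\<xi>1 u)\<^sup>2 + (K u)\<^sup>2 = N u" by (simp add: N_def)
      show "(\<xi>1 has_real_derivative deriv \<xi>1 u) (at u)" "(\<xi>2 has_real_derivative deriv \<xi>2 u) (at u)"
        using smooth_on_has_real_derivative \<xi> u by blast+
      show "(deriv \<xi>1 u)\<^sup>2 / (B u)\<^sup>2 + (\<xi>1 u)\<^sup>2 * (deriv \<xi>2 u)\<^sup>2 / ((\<xi>1 u)\<^sup>2 + (K u)\<^sup>2) = 1"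
        using arc u unfolding arc_length_profile_def Let_def K_def B_def by blast
      show "\<eta> u * ((\<xi>1 u)\<^sup>2 + (K u)\<^sup>2) = - K u * B u * deriv \<xi>2 u"
        using nz[OF u] unfolding Nf by (simp add: \<eta>_def)
      show "(\<xi>1 u)\<^sup>2 + (K u)\<^sup>2 = 1\<^sup>2 * (U u)\<^sup>2 * (B u)\<^sup>2"
        using nz[OF u] N0[OF u] unfolding Nf by (simp add: U_def power_divide)
      show "B u \<noteq> 0" "U u \<noteq> 0" using nz[OF u] N0[OF u] by (simp_all add: U_def)
    qed (simp_all add: B_def K_def)
    then show "has_natural_form \<kappa> \<tau> (J \<times> UNIV) (\<lambda>(u, t). helicoid_param a \<xi>1 \<xi>2 (u, t + h u)) U"
      by simp
  qed
qed

text \<open>The shifted given surface and all explicit surfaces share the same \<open>U\<close>,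
  hence the same first fundamental form in \<open>(u, t)\<close>. The open set \<open>P\<close>
  around some \<open>(m, 0)\<close> provides the two parameters, and pitch \<open>0\<close> gives
  the rotation surface.\<close>

lemma isometric_helicoidal_family:
  assumes I: "open_interval I" "u0 \<in> I" and \<xi>: "smooth_on I \<xi>1" "smooth_on I \<xi>2"
    and pos: "\<And>u. u \<in> I \<Longrightarrow> 0 < \<xi>1 u" "\<And>u. u \<in> I \<Longrightarrow> 0 < bcv_B \<kappa> ((\<xi>1 u)\<^sup>2)"
    and arc: "arc_length_profile \<kappa> \<tau> a0 I \<xi>1 \<xi>2"
  shows "\<exists>J U h X0 P F.
           open_interval J \<and> u0 \<in> J \<and> J \<subseteq> I \<and>
           smooth_on J U \<and> (\<forall>u\<in>J. 0 < U u) \<and> smooth_on J h \<and>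
           X0 = (\<lambda>(u, t). helicoid_param a0 \<xi>1 \<xi>2 (u, t + h u)) \<and>
           has_natural_form \<kappa> \<tau> (J \<times> UNIV) X0 U \<and>
           open (P :: (real \<times> real) set) \<and>
           (\<forall>(m, a)\<in>P.
              bour_surface \<kappa> \<tau> J U m a (F m a) \<and>
              helicoidal_surface \<kappa> a (J \<times> UNIV) (F m a) \<and>
              isometric_on \<kappa> \<tau> (J \<times> UNIV) X0 (F m a)) \<and>
           (\<exists>m. (m, 0) \<in> P \<and> rotation_surface \<kappa> (J \<times> UNIV) (F m 0))"
proof -
  have oI: "open I" using I(1) by (simp add: open_interval_def)
  obtain U \<eta> where U: "smooth_on I U" "\<And>u. u \<in> I \<Longrightarrow> 0 < U u" and \<eta>: "smooth_on I \<eta>"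
    and nf: "\<And>J h. J \<subseteq> I \<Longrightarrow> (\<And>u. u \<in> J \<Longrightarrow> (h has_real_derivative \<eta> u) (at u)) \<Longrightarrow>
       has_natural_form \<kappa> \<tau> (J \<times> UNIV) (\<lambda>(u, t). helicoid_param a0 \<xi>1 \<xi>2 (u, t + h u)) U"
    using helicoidal_surface_natural_parameters[OF oI \<xi> pos arc] by blast
  obtain A P m where A: "open A" "u0 \<in> A" "A \<subseteq> I" and P: "open P" "(m, 0) \<in> P"
    and adm: "\<And>m a. (m, a) \<in> P \<Longrightarrow> bour_admissible \<kappa> \<tau> A U m a"
    using bour_admissible_near[OF oI I(2) U(1) U(2)[OF I(2)]] by blast
  \<comment> \<open>The closed interval inside \<open>A\<close> carries all the integrations, and
    its interior is the common \<open>J\<close> for every parameter pair.\<close>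
  obtain e where e: "0 < e" "cball u0 e \<subseteq> A"
    using A(1,2) open_contains_cball by blast
  define J where "J = {u0 - e<..<u0 + e}"
  have cA: "{u0 - e..u0 + e} \<subseteq> A" using e(2) by (simp add: cball_eq_atLeastAtMost)
  moreover have "J \<subseteq> {u0 - e..u0 + e}" by (auto simp: J_def)
  ultimately have JI: "J \<subseteq> I" using A(3) by blast
  have oJ: "open J" by (simp add: J_def)
  have UJ: "smooth_on J U" "\<And>u. u \<in> J \<Longrightarrow> 0 < U u"
    using U JI smooth_on_subset by blast+
  have "continuous_on {u0 - e..u0 + e} \<eta>"
    using smooth_on_continuous[OF \<eta>] cA A(3) by (blast intro: continuous_on_subset)
  then obtain h where h: "\<And>u. u \<in> J \<Longrightarrow> (h has_real_derivative \<eta> u) (at u)"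
    using real_antiderivative unfolding J_def by blast
  define X0 where "X0 = (\<lambda>(u, t). helicoid_param a0 \<xi>1 \<xi>2 (u, t + h u))"
  have X0: "has_natural_form \<kappa> \<tau> (J \<times> UNIV) X0 U"
    unfolding X0_def by (rule nf[OF JI h])
  have "\<exists>X. bour_surface \<kappa> \<tau> J U m a X" if "(m, a) \<in> P" for m a
    unfolding J_def
    by (rule bour_surface_exists[OF A(1) cA _ _ adm[OF that]]) (use U A(3) smooth_on_subset in blast)+
  \<comment> \<open>One surface is chosen for each pair separately; no regularity in
    \<open>(m, a)\<close> is claimed.\<close>
  then obtain F where F: "\<And>m a. (m, a) \<in> P \<Longrightarrow> bour_surface \<kappa> \<tau> J U m a (F m a)"
    by metis
  note props = bour_surface_properties[OF oJ UJ F]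
  have "open_interval J" by (simp add: open_interval_def J_def is_interval_oo)
  moreover have "u0 \<in> J" using e(1) by (simp add: J_def)
  moreover have "smooth_on J h"
    by (rule smooth_on_antiderivative[OF oJ smooth_on_subset[OF \<eta> JI] h])
  moreover have "\<forall>(m, a)\<in>P. bour_surface \<kappa> \<tau> J U m a (F m a) \<and>
      helicoidal_surface \<kappa> a (J \<times> UNIV) (F m a) \<and> isometric_on \<kappa> \<tau> (J \<times> UNIV) X0 (F m a)"
    using F props has_natural_form_imp_isometric[OF X0] by blast
  moreover have "rotation_surface \<kappa> (J \<times> UNIV) (F m 0)"
    unfolding rotation_surface_def using props(2)[OF _ P(2)] by blast
  ultimately show ?thesis
    using JI UJ X0 P X0_def by (intro exI[of _ J] exI[of _ U] exI[of _ h] exI[of _ X0] exI[of _ P] exI[of _ F]) blast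
qed

theorem theorem3p1:
  fixes \<kappa> \<tau> :: real
  shows
    "(\<forall>(a0::real) I \<xi>1 \<xi>2 u0.
        open_interval I \<and> u0 \<in> I \<and> smooth_on I \<xi>1 \<and> smooth_on I \<xi>2 \<and>
        (\<forall>u\<in>I. 0 < \<xi>1 u \<and> 0 < bcv_B \<kappa> ((\<xi>1 u)\<^sup>2)) \<and>
        arc_length_profile \<kappa> \<tau> a0 I \<xi>1 \<xi>2
        \<longrightarrow>
        (\<exists>J U h X0 P F.
           open_interval J \<and> u0 \<in> J \<and> J \<subseteq> I \<and>
           smooth_on J U \<and> (\<forall>u\<in>J. 0 < U u) \<and> smooth_on J h \<and>
           X0 = (\<lambda>(u, t). helicoid_param a0 \<xi>1 \<xi>2 (u, t + h u)) \<and>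
           has_natural_form \<kappa> \<tau> (J \<times> UNIV) X0 U \<and>
           open (P :: (real \<times> real) set) \<and>
           (\<forall>(m, a)\<in>P.
              bour_surface \<kappa> \<tau> J U m a (F m a) \<and>
              helicoidal_surface \<kappa> a (J \<times> UNIV) (F m a) \<and>
              isometric_on \<kappa> \<tau> (J \<times> UNIV) X0 (F m a)) \<and>
           (\<exists>m. (m, 0) \<in> P \<and> rotation_surface \<kappa> (J \<times> UNIV) (F m 0))))
     \<and>
     (\<forall>J U.
        open_interval J \<and> smooth_on J U \<and> (\<forall>u\<in>J. 0 < U u)
        \<longrightarrow>
        (\<forall>m a X. bour_surface \<kappa> \<tau> J U m a X \<longrightarrow>
           helicoidal_surface \<kappa> a (J \<times> UNIV) X \<and>
           has_natural_form \<kappa> \<tau> (J \<times> UNIV) X U) \<and>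
        (\<forall>m a X m' a' X'.
           bour_surface \<kappa> \<tau> J U m a X \<and> bour_surface \<kappa> \<tau> J U m' a' X' \<longrightarrow>
           isometric_on \<kappa> \<tau> (J \<times> UNIV) X X'))"
proof (rule conjI, goal_cases)
  case 1
  show ?case
    by (intro allI impI, elim conjE, rule isometric_helicoidal_family) auto
next
  case 2
  have nf: "has_natural_form \<kappa> \<tau> (J \<times> UNIV) X U" and hs: "helicoidal_surface \<kappa> a (J \<times> UNIV) X"
    if "open_interval J \<and> smooth_on J U \<and> (\<forall>u\<in>J. 0 < U u)" "bour_surface \<kappa> \<tau> J U m a X"
    for J U m a X
    using that bour_surface_properties[of J U \<kappa> \<tau> m a X] by (auto simp: open_interval_def)
  show ?case
    using nf hs has_natural_form_imp_isometric[OF nf nf] by (intro allI impI conjI) blast+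
qed

end
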